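(* Let $N\ge2$, let $\beta_\ell>0$ be a constant, let $B_\varrho:=\{x\in\mathbb{R}^N:|x|<\varrho\}$ for $\varrho>0$, and define $$\Sigma(R):=\sigma_1[-\Delta,\beta_\ell R,B_1],\qquad R\in\mathbb{R},$$ so that $\Sigma(R)=R^2\sigma_1[-\Delta,\beta_\ell,B_R]$ for $R>0$. Then the mapping $R\mapsto\Sigma(R)$ is real analytic. Moreover, $$\Sigma(R)=\beta_\ell\,\frac{\mathrm{Area}(\partial B_1)}{|B_1|}\,R+O(R^2)\quad\text{as }R\downarrow0.$$ Thus, $$\lim_{R\downarrow0}\frac{\Sigma(R)}{R}=\beta_\ell\,\frac{\mathrm{Area}(\partial B_1)}{|B_1|},$$ and $$\sigma_1[-\Delta,\beta_\ell,B_R]=\frac{\Sigma(R)}{R^2}=\beta_\ell\,\frac{\mathrm{Area}(\partial B_1)}{|B_1|}\,\frac1R+O(1)\quad\text{as }R\downarrow0.$$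
   Context: For a ball $B_\varrho$ and a constant $b\in\mathbb{R}$, $\sigma_1[-\Delta,b,B_\varrho]$ denotes the principal eigenvalue of $-\Delta u=\sigma u$ in $B_\varrho$, $\frac{\partial u}{\partial n}+b\,u=0$ on $\partial B_\varrho$, where $n$ is the outward unit normal; that is, the unique real number $\sigma$ for which this problem admits a positive eigenfunction (it is known that it exists and is the smallest eigenvalue). $|B_1|$ is the Lebesgue measure of $B_1$ and $\mathrm{Area}(\partial B_1)$ is the $(N-1)$-dimensional surface measure of the unit sphere. *)

theory Defs
  imports "HOL-Analysis.Analysis" "HOL-Library.Landau_Symbols"
begin

text \<open>
  \<^bold>\<open>The Robin problem on a ball.\<close>
  The space $\mathbb{R}^N$ is a type of class \<^class>\<open>euclidean_space\<close>, with $N$ its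
  dimension. Solutions are classical: \<open>u\<close> is $C^1$ up to the boundary and $C^2$ in the open ball.
  The witness \<open>G\<close> is the gradient of \<open>u\<close> (on the sphere: its continuous extension), and \<open>H\<close> is
  the derivative of \<open>G\<close>, i.e. the Hessian, whose trace is the Laplacian. The outward unit normal
  at a point \<open>x\<close> of the sphere of radius \<open>\<rho>\<close> about the origin is \<open>x /\<^sub>R \<rho>\<close>.
\<close>

definition robin_solution :: "real \<Rightarrow> real \<Rightarrow> real \<Rightarrow> ('a::euclidean_space \<Rightarrow> real) \<Rightarrow> bool" where
  "robin_solution b \<rho> \<sigma> u \<longleftrightarrow>
    (\<exists>(G :: 'a \<Rightarrow> 'a) (H :: 'a \<Rightarrow> 'a \<Rightarrow>\<^sub>L 'a).
       (\<forall>x\<in>cball 0 \<rho>. (u has_derivative (\<lambda>h. G x \<bullet> h)) (at x within cball 0 \<rho>)) \<and>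
       continuous_on (cball 0 \<rho>) G \<and>
       (\<forall>x\<in>ball 0 \<rho>. (G has_derivative blinfun_apply (H x)) (at x)) \<and>
       continuous_on (ball 0 \<rho>) H \<and>
       (\<forall>x\<in>ball 0 \<rho>. - (\<Sum>i\<in>Basis. blinfun_apply (H x) i \<bullet> i) = \<sigma> * u x) \<and>
       (\<forall>x\<in>sphere 0 \<rho>. G x \<bullet> (x /\<^sub>R \<rho>) + b * u x = 0))"

text \<open>
  $\sigma_1[-\Delta, b, B_\rho]$; the first argument only selects the ambient space.
\<close>

definition principal_eigenvalue :: "'a::euclidean_space itself \<Rightarrow> real \<Rightarrow> real \<Rightarrow> real" where
  "principal_eigenvalue _ b \<rho> =
    (THE \<sigma>. \<exists>u :: 'a \<Rightarrow> real. robin_solution b \<rho> \<sigma> u \<and> (\<forall>x\<in>ball 0 \<rho>. u x > 0))"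

definition Sigma_fun :: "'a::euclidean_space itself \<Rightarrow> real \<Rightarrow> real \<Rightarrow> real" where
  "Sigma_fun T \<beta> R = principal_eigenvalue T (\<beta> * R) 1"

definition real_analytic_on :: "(real \<Rightarrow> real) \<Rightarrow> real set \<Rightarrow> bool" where
  "real_analytic_on f S \<longleftrightarrow>
    (\<forall>x0\<in>S. \<exists>r>0. \<exists>a :: nat \<Rightarrow> real. \<forall>x. \<bar>x - x0\<bar> < r \<longrightarrow> (\<lambda>n. a n * (x - x0) ^ n) sums f x)"

text \<open>
  \<^bold>\<open>Surface area.\<close>
  Lebesgue measure of dimension $N-1$ on the coordinate hyperplane orthogonal to a basis vector
  \<open>e\<close>, built like \<^const>\<open>lborel\<close> but with the coordinate \<open>e\<close> left out.
\<close>

definition hyperplane_lborel :: "'a::euclidean_space \<Rightarrow> 'a measure" where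
  "hyperplane_lborel e =
     distr (\<Pi>\<^sub>M b\<in>Basis - {e}. lborel) borel (\<lambda>f. \<Sum>b\<in>Basis - {e}. f b *\<^sub>R b)"

text \<open>
  Surface area of the graph $\{y + g(y) e : y \in U\}$ of a $C^1$ function \<open>g\<close> on a relatively
  open part \<open>U\<close> of that hyperplane, namely
  $\int_U \sqrt{1 + |\nabla g|^2}$ with the gradient taken inside the hyperplane.
\<close>

definition graph_area :: "'a::euclidean_space \<Rightarrow> 'a set \<Rightarrow> ('a \<Rightarrow> real) \<Rightarrow> ennreal" where
  "graph_area e U g =
     (\<integral>\<^sup>+y\<in>U. ennreal (sqrt (1 + (\<Sum>b\<in>Basis - {e}. (deriv (\<lambda>t. g (y + t *\<^sub>R b)) 0)\<^sup>2)))
        \<partial>hyperplane_lborel e)"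

text \<open>
  The unit sphere is the disjoint union of the two open hemispheres on either side of the
  hyperplane orthogonal to \<open>e\<close>, which are graphs over the open unit disc of the hyperplane, and of
  the equator, which has dimension $N-2$ and does not contribute. By symmetry the choice of \<open>e\<close>
  is immaterial.
\<close>

definition unit_sphere_area :: "'a::euclidean_space itself \<Rightarrow> real" where
  "unit_sphere_area _ =
    (let e = (SOME e :: 'a. e \<in> Basis);
         D = {y. y \<bullet> e = 0 \<and> norm y < 1}
     in enn2real (graph_area e D (\<lambda>y. sqrt (1 - (norm y)\<^sup>2)) +
                  graph_area e D (\<lambda>y. - sqrt (1 - (norm y)\<^sup>2))))"

end

theory Submission
  imports Defs "HOL-Complex_Analysis.Conformal_Mappings"
begin

text \<open>
  Everything reduces to one entire function of one variable. Put $a = N/2$ and let $\varphi$ be the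
  power series with $\varphi(0) = 1$ that solves $z\varphi'' + a\varphi' + \varphi/4 = 0$ (a Bessel
  function in the variable $z = r^2$, called \<open>radial a\<close>). Then $\varphi(\tau|x|^2)$ solves
  $-\Delta u = \tau u$, and it satisfies the Robin condition with constant $b$ on the sphere of radius
  $\varrho$ iff $p(\tau\varrho^2) = b\varrho$, where $p(z) = -2z\varphi'(z)/\varphi(z)$ is \<open>robin_quot a\<close>.

  On the interval where $\varphi$ has not yet vanished, $p$ is an increasing bijection onto the real
  line with strictly positive derivative (\<open>robin_slope_pos\<close>, \<open>robin_quot_bij\<close>). So for
  every $b$ there is exactly one radial solution, up to multiples, that is positive on the closed ball.

  No other eigenvalue has a positive eigenfunction, radial or not (\<open>principal_eigenvalue_ball\<close>).
  The reason is comparison: the quotient of a positive solution by a radial solution attains its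
  minimum and its maximum on the closed ball, and at such a point of contact either the
  Laplacians or the normal derivatives are ordered. The one delicate point, that a positive
  solution cannot vanish on the sphere, is the Hopf lemma \<open>robin_hopf\<close>.

  Hence $\sigma_1[-\Delta,b,B_\varrho] = p^{-1}(b\varrho)/\varrho^2$. This contains the scaling relation, and
  $\Sigma(R) = p^{-1}(\beta_\ell R)$. Since $p$ is a quotient of entire functions with nonzero
  derivative on the interval, the holomorphic inverse function theorem makes $p^{-1}$ real analytic
  (\<open>robin_inv_analytic\<close>). From $p(0) = 0$ and $p'(0) = 1/(2a) = 1/N$ one reads off
  $\Sigma(R) = \beta_\ell N R + O(R^2)$. Finally $N$ is the ratio of the area of the unit sphere to the
  volume of the unit ball (\<open>unit_sphere_area_eq\<close>): the area of the two hemispheres, as graphs, is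
  a Beta integral.
\<close>

section \<open>The radial profile\<close>

text \<open>
  The coefficients of the hypergeometric function ${}_0F_1(;a;-z/4)$. For $a = N/2$ it is, up to a
  constant, $|x|^{1-a}J_{a-1}(|x|)$ at $z = |x|^2$: the profile of the radial solutions of
  $-\Delta u = u$ in $\mathbb{R}^N$. The argument is the square of the radius, which keeps the
  function entire and covers both signs of the eigenvalue. The field is left open so
  that the same series serves on the line and in the complex plane.
\<close>

definition radial_coeff :: "real \<Rightarrow> nat \<Rightarrow> real" where
  "radial_coeff a k = (-1) ^ k / (4 ^ k * fact k * pochhammer a k)"

definition radial :: "real \<Rightarrow> 'b \<Rightarrow> 'b::{real_normed_field,banach}" where
  "radial a z = (\<Sum>k. of_real (radial_coeff a k) * z ^ k)"

text \<open>
  Differentiating ${}_0F_1$ shifts its parameter. Using this as the definition of the first two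
  derivatives avoids manipulating differentiated series.
\<close>

definition radial' :: "real \<Rightarrow> 'b \<Rightarrow> 'b::{real_normed_field,banach}" where
  "radial' a z = - radial (a + 1) z / of_real (4 * a)"

definition radial'' :: "real \<Rightarrow> 'b \<Rightarrow> 'b::{real_normed_field,banach}" where
  "radial'' a z = - radial' (a + 1) z / of_real (4 * a)"

lemma pochhammer_ge_1: "1 \<le> a \<Longrightarrow> 1 \<le> pochhammer (a :: real) k"
proof (induction k)
  case (Suc k)
  have "1 * 1 \<le> pochhammer a k * (a + real k)"
    using Suc by (intro mult_mono) auto
  then show ?case by (simp add: pochhammer_Suc)
qed simp

lemma abs_radial_coeff_le:
  assumes "1 \<le> a"
  shows "\<bar>radial_coeff a k\<bar> \<le> inverse (fact k)"
proof -
  have p: "1 \<le> pochhammer a k" using assms by (rule pochhammer_ge_1)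
  have "1 * fact k * 1 \<le> 4 ^ k * fact k * pochhammer a k"
    using p by (intro mult_mono) auto
  then show ?thesis
    using p by (simp add: radial_coeff_def abs_mult power_abs divide_simps)
qed

lemma summable_radial:
  fixes z :: "'b::{real_normed_field,banach}"
  assumes "1 \<le> a"
  shows "summable (\<lambda>k. of_real (radial_coeff a k) * z ^ k)"
proof (rule summable_comparison_test')
  show "summable (\<lambda>k. inverse (fact k) * norm z ^ k)"
    by (rule summable_exp)
  show "norm (of_real (radial_coeff a k) * z ^ k) \<le> inverse (fact k) * norm z ^ k" if "k \<ge> 0" for k
    using abs_radial_coeff_le[OF assms]
    by (simp add: norm_mult norm_power mult_right_mono)
qed

lemma radial_0 [simp]: "radial a 0 = 1"
proof -
  have "(\<lambda>k. of_real (radial_coeff a k) * (0 :: 'a) ^ k) sums of_real (radial_coeff a 0)"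
    by (rule powser_sums_zero)
  then show ?thesis
    by (simp add: radial_def sums_iff radial_coeff_def)
qed

lemma radial_of_real:
  assumes "1 \<le> a"
  shows "radial a (of_real x) = (of_real (radial a x) :: 'b::{real_normed_field,banach})"
proof -
  have "of_real (radial a x) = (\<Sum>k. of_real (radial_coeff a k * x ^ k) :: 'b)"
    unfolding radial_def using suminf_of_real[OF summable_radial[OF assms, of x]] by (simp only: of_real_eq_id id_apply)
  then show ?thesis by (simp only: radial_def of_real_mult of_real_power)
qed

lemma radial'_of_real: "1 \<le> a \<Longrightarrow> radial' a (of_real x) = of_real (radial' a x)"
  by (simp add: radial'_def radial_of_real)

lemma DERIV_radial:
  assumes "1 \<le> a"
  shows "(radial a has_field_derivative radial' a z) (at (z :: 'b::{real_normed_field,banach}))"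
proof -
  let ?c = "\<lambda>k. of_real (radial_coeff a k) :: 'b"
  have a: "a > 0" "1 \<le> a + 1" using assms by auto
  have coeff: "diffs ?c k = - (1 / of_real (4 * a)) * of_real (radial_coeff (a + 1) k)" for k
  proof -
    have "pochhammer a (Suc k) = a * pochhammer (a + 1) k"
      by (rule pochhammer_rec)
    moreover have "pochhammer (a + 1) k \<noteq> 0"
      using pochhammer_ge_1[OF a(2), of k] by auto
    ultimately have "(real k + 1) * radial_coeff a (Suc k) = - (1 / (4 * a)) * radial_coeff (a + 1) k"
      using a by (simp add: radial_coeff_def divide_simps)
    from arg_cong[OF this, of "of_real :: real \<Rightarrow> 'b"] show ?thesis
      by (simp add: diffs_def add.commute)
  qed
  have "((\<lambda>z. \<Sum>k. ?c k * z ^ k) has_field_derivative (\<Sum>k. diffs ?c k * z ^ k)) (at z)"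
    by (rule termdiffs_strong_converges_everywhere) (rule summable_radial[OF assms])
  also have "(\<Sum>k. diffs ?c k * z ^ k) = radial' a z"
    unfolding coeff radial'_def radial_def
    using suminf_mult[OF summable_radial[OF a(2), of z], of "- (1 / of_real (4 * a))"]
    by (simp add: mult.assoc)
  finally show ?thesis by (simp add: radial_def[abs_def])
qed

lemma DERIV_radial':
  assumes "1 \<le> a"
  shows "(radial' a has_field_derivative radial'' a z) (at (z :: 'b::{real_normed_field,banach}))"
proof -
  have "((\<lambda>z. - radial (a + 1) z / of_real (4 * a)) has_field_derivative
      - radial' (a + 1) z / of_real (4 * a)) (at z)"
    using assms by (intro DERIV_cdivide DERIV_minus DERIV_radial) simp
  moreover have "(\<lambda>z. - radial (a + 1) z / of_real (4 * a)) = (radial' a :: 'b \<Rightarrow> 'b)"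
    by (simp add: fun_eq_iff radial'_def)
  ultimately show ?thesis by (simp only: radial''_def)
qed

lemmas DERIV_radial_chain [derivative_intros] =
  DERIV_chain2[OF DERIV_radial] DERIV_chain2[OF DERIV_radial']

text \<open>
  The three-term relation between contiguous ${}_0F_1$ functions. Since shifted parameters are
  derivatives, it is the differential equation in disguise.
\<close>

lemma radial_contiguous:
  fixes z :: "'b::{real_normed_field,banach}"
  assumes "1 \<le> a"
  shows "radial a z = radial (a + 1) z - z * radial (a + 2) z / of_real (4 * a * (a + 1))"
proof -
  let ?c = "\<lambda>b k. of_real (radial_coeff b k) :: 'b"
  have coeff: "radial_coeff a (Suc k) =
      radial_coeff (a + 1) (Suc k) - radial_coeff (a + 2) k / (4 * a * (a + 1))" for k
  proof -
    define P where "P = pochhammer (a + 1) k"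
    define Q where "Q = pochhammer (a + 2) k"
    have P: "P \<ge> 1" and Q: "Q \<ge> 1"
      using pochhammer_ge_1[of "a + 1" k] pochhammer_ge_1[of "a + 2" k] assms by (auto simp: P_def Q_def)
    have 1: "pochhammer a (Suc k) = a * P" by (simp add: pochhammer_rec P_def)
    have 2: "pochhammer (a + 1) (Suc k) = P * (a + 1 + real k)" by (simp add: pochhammer_Suc P_def)
    have 3: "pochhammer (a + 1) (Suc k) = (a + 1) * Q"
      using pochhammer_rec[of "a + 1" k] by (simp add: Q_def add.assoc)
    have Qe: "Q = P * (a + 1 + real k) / (a + 1)"
      using 2 3 assms by (simp add: field_simps)
    have nz: "a \<noteq> 0" "a + 1 \<noteq> 0" "a + 1 + real k \<noteq> 0" "P \<noteq> 0" using assms P by auto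
    show ?thesis
      unfolding radial_coeff_def 1 2 Q_def[symmetric] Qe using nz
      by (simp add: divide_simps) (simp add: algebra_simps)
  qed
  have S: "summable (\<lambda>k. ?c b k * z ^ k)" if "1 \<le> b" for b
    using summable_radial[OF that] .
  have head: "radial b z = 1 + (\<Sum>k. ?c b (Suc k) * z ^ Suc k)" if "1 \<le> b" for b
    using suminf_split_head[OF S[OF that]] by (simp add: radial_def radial_coeff_def)
  have S': "summable (\<lambda>k. ?c b (Suc k) * z ^ Suc k)" if "1 \<le> b" for b
    using S[OF that] by (subst summable_Suc_iff)
  have "(\<Sum>k. ?c a (Suc k) * z ^ Suc k) = (\<Sum>k. ?c (a + 1) (Suc k) * z ^ Suc k -
      z / of_real (4 * a * (a + 1)) * (?c (a + 2) k * z ^ k))"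
    unfolding coeff by (simp add: algebra_simps)
  also have "\<dots> = (\<Sum>k. ?c (a + 1) (Suc k) * z ^ Suc k) -
      z / of_real (4 * a * (a + 1)) * radial (a + 2) z"
    unfolding radial_def using assms
    by (subst suminf_diff[symmetric], (intro summable_mult S S'; simp)+)
       (subst suminf_mult, auto intro: S)
  finally show ?thesis using assms by (simp add: head)
qed

text \<open>
  For $u(x) = \varphi(\tau|x|^2)$ one has
  $\Delta u = 4\tau\,(z\varphi'' + \frac N2 \varphi')$ at $z = \tau|x|^2$, so this equation with
  $a = N/2$ says $-\Delta u = \tau u$.
\<close>

lemma radial_ode:
  fixes z :: "'b::{real_normed_field,banach}"
  assumes "1 \<le> a"
  shows "z * radial'' a z = - of_real a * radial' a z - radial a z / 4"
proof -
  have nz: "(of_real a :: 'b) \<noteq> 0" "(of_real a + 1 :: 'b) \<noteq> 0" "(4::'b) \<noteq> 0"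
  proof -
    have "of_real a \<noteq> (0 :: 'b)" "of_real (a + 1) \<noteq> (0 :: 'b)"
      using assms by (simp_all only: of_real_eq_0_iff)
    then show "(of_real a :: 'b) \<noteq> 0" "(of_real a + 1 :: 'b) \<noteq> 0" by simp_all
  qed simp
  have "radial'' a z = radial (a + 2) z / (of_real (4 * a) * of_real (4 * (a + 1)))"
  proof -
    have "a + 1 + 1 = a + 2" by simp
    then show ?thesis by (simp only: radial''_def radial'_def) simp
  qed
  also have "\<dots> = radial (a + 2) z / (16 * (of_real a * (of_real a + 1)))"
    by (simp add: algebra_simps)
  finally have "radial'' a z = radial (a + 2) z / (16 * (of_real a * (of_real a + 1)))" .
  then show ?thesis
    using nz unfolding radial'_def radial_contiguous[OF assms, of z]
    by (simp add: divide_simps)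
qed

lemma continuous_on_radial [continuous_intros]:
  fixes f :: "'c::topological_space \<Rightarrow> 'b::{real_normed_field,banach}"
  assumes "1 \<le> a" "continuous_on S f"
  shows "continuous_on S (\<lambda>x. radial a (f x))" "continuous_on S (\<lambda>x. radial' a (f x))"
    "continuous_on S (\<lambda>x. radial'' a (f x))"
proof -
  have 1: "continuous_on UNIV (radial b :: 'b \<Rightarrow> 'b)" if "1 \<le> b" for b
    using DERIV_radial[OF that] by (meson DERIV_continuous_on DERIV_subset subset_UNIV)
  have c: "continuous_on S (\<lambda>x. radial b (f x))" if "1 \<le> b" for b
    using continuous_on_compose2[OF 1[OF that] assms(2)] by simp
  show "continuous_on S (\<lambda>x. radial a (f x))" "continuous_on S (\<lambda>x. radial' a (f x))"
    "continuous_on S (\<lambda>x. radial'' a (f x))"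
    using assms(1) unfolding radial'_def radial''_def
    by (intro continuous_intros c; force simp flip: of_real_add of_real_mult)+
qed

text \<open>
  On the negative half-line all terms of the series have the same sign, so each single term is a
  lower bound: growth faster than every power.
\<close>

lemma radial_pos_growth:
  assumes "1 \<le> a"
  shows "\<exists>c>0. \<forall>y\<ge>0. c * y ^ k \<le> radial a (- y :: real)"
proof -
  define c where "c = (\<lambda>k. 1 / (4 ^ k * fact k * pochhammer a k))"
  have cpos: "c k > 0" for k
    using pochhammer_ge_1[OF assms, of k] by (simp add: c_def)
  have "c k * y ^ k \<le> radial a (- y)" if "y \<ge> 0" for y
  proof -
    have eq: "of_real (radial_coeff a k) * (- y) ^ k = c k * y ^ k" for k
      by (simp add: radial_coeff_def c_def power_minus[of y])
    have S: "summable (\<lambda>k. c k * y ^ k)"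
      using summable_radial[OF assms, of "- y"] unfolding eq .
    have "sum (\<lambda>k. c k * y ^ k) {k} \<le> (\<Sum>k. c k * y ^ k)"
      by (rule sum_le_suminf[OF S]) (use that cpos in \<open>auto intro!: mult_nonneg_nonneg less_imp_le[OF cpos]\<close>)
    then show ?thesis unfolding radial_def eq by simp
  qed
  with cpos show ?thesis by blast
qed

lemma radial_pos_of_nonpos:
  assumes "1 \<le> a" "z \<le> (0 :: real)"
  shows "radial a z > 0"
proof -
  obtain c where "c > 0" "\<And>y. y \<ge> 0 \<Longrightarrow> c * y ^ 0 \<le> radial a (- y :: real)"
    using radial_pos_growth[OF assms(1)] by metis
  from this(1) this(2)[of "- z"] assms(2) show ?thesis by simp
qed

section \<open>The Robin quotient and its inverse\<close>

text \<open>
  $t \mapsto t^a X(tz)$ vanishes at $0$ and has derivative $t^{a-1}(aX + yX')$ at $y = tz$. Hence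
  positivity of $aX + yX'$ along the segment from $0$ to $z$ gives $X(z) > 0$. With $a = N/2$ and
  $t = r^2$ this is integration against $r^{N-1}\,dr$. The signs of $\varphi'$ and of the slope of the
  Robin quotient come from it.
\<close>

lemma euler_operator_pos:
  fixes X X' :: "real \<Rightarrow> real"
  assumes a: "a > 0" and X: "\<And>y. (X has_real_derivative X' y) (at y)"
    and pos: "\<And>t. 0 < t \<Longrightarrow> t < 1 \<Longrightarrow> a * X (t * z) + t * z * X' (t * z) > 0"
  shows "X z > 0"
proof -
  let ?g = "\<lambda>t. t powr a * X (t * z)"
  have contX: "continuous_on UNIV X"
    using X by (meson DERIV_continuous_on DERIV_subset subset_UNIV)
  have "?g 0 < ?g 1"
  proof (rule DERIV_pos_imp_increasing_open[where f = ?g])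
    show "continuous_on {0..1} ?g"
      using a by (intro continuous_on_mult continuous_on_powr' continuous_on_compose2[OF contX]
          continuous_intros) auto
    show "\<exists>y. (?g has_real_derivative y) (at t) \<and> 0 < y" if t: "0 < t" "t < 1" for t
    proof (intro exI conjI)
      have 1: "((\<lambda>t. t powr a) has_real_derivative a * t powr (a - 1)) (at t)"
        by (rule has_real_derivative_powr) fact
      have 2: "((\<lambda>t. X (t * z)) has_real_derivative X' (t * z) * z) (at t)"
        by (rule DERIV_chain2[OF X]) (auto intro!: derivative_eq_intros)
      show "(?g has_real_derivative (a * t powr (a - 1) * X (t * z) + X' (t * z) * z * t powr a)) (at t)"
        using DERIV_mult[OF 1 2] by simp
      have "t powr a = t powr (a - 1) * t"
        using t by (simp add: powr_diff)
      then have "a * t powr (a - 1) * X (t * z) + X' (t * z) * z * t powr a =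
          t powr (a - 1) * (a * X (t * z) + t * z * X' (t * z))"
        by (simp add: algebra_simps)
      also have "\<dots> > 0" using t pos[OF t] by simp
      finally show "a * t powr (a - 1) * X (t * z) + X' (t * z) * z * t powr a > 0" .
    qed
  qed simp
  then show ?thesis by simp
qed

text \<open>
  The interval to the left of the first positive zero of \<open>radial a\<close> (the whole line if there were
  none): the values $z = \tau\varrho^2$ for which the radial solution is positive on the closed
  ball of radius $\varrho$.
\<close>

definition radial_dom :: "real \<Rightarrow> real set" where
  "radial_dom a = {z. \<forall>y\<le>z. radial a y > 0}"

text \<open>
  The radial solution with parameter $\tau$ satisfies the Robin condition on the sphere of radius
  $\varrho$ with constant $b$ exactly when this function takes the value $b\varrho$ at
  $\tau\varrho^2$.
\<close>

definition robin_quot :: "real \<Rightarrow> 'b \<Rightarrow> 'b::{real_normed_field,banach}" where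
  "robin_quot a z = - 2 * z * radial' a z / radial a z"

text \<open>
  The numerator of the derivative of \<open>robin_quot\<close>, with the second derivative eliminated by the
  differential equation.
\<close>

definition robin_slope :: "real \<Rightarrow> 'b \<Rightarrow> 'b::{real_normed_field,banach}" where
  "robin_slope a z =
     2 * (of_real a - 1) * radial a z * radial' a z + (radial a z)\<^sup>2 / 2 + 2 * z * (radial' a z)\<^sup>2"

lemma DERIV_robin_quot:
  assumes "1 \<le> a" "radial a z \<noteq> 0"
  shows "(robin_quot a has_field_derivative robin_slope a z / (radial a z)\<^sup>2) (at z)"
proof -
  have "(robin_quot a has_field_derivative
      ((- 2 * radial' a z - 2 * (z * radial'' a z)) * radial a z + 2 * z * radial' a z * radial' a z) /
        (radial a z * radial a z)) (at z)"
    unfolding robin_quot_def[abs_def] using assms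
    by (auto intro!: derivative_eq_intros simp: field_simps)
  also have "(- 2 * radial' a z - 2 * (z * radial'' a z)) * radial a z +
      2 * z * radial' a z * radial' a z = robin_slope a z"
    unfolding radial_ode[OF assms(1)] robin_slope_def by (simp add: algebra_simps power2_eq_square)
  finally show ?thesis by (simp add: power2_eq_square)
qed

context
  fixes a :: real
  assumes a: "1 \<le> a"
begin

lemma radial_dom_nonpos: "z \<le> 0 \<Longrightarrow> z \<in> radial_dom a"
  using radial_pos_of_nonpos[OF a] by (auto simp: radial_dom_def)

lemma radial_dom_down: "z \<in> radial_dom a \<Longrightarrow> y \<le> z \<Longrightarrow> y \<in> radial_dom a"
  by (auto simp: radial_dom_def)

lemma radial_dom_mult:
  assumes "\<tau> * S \<in> radial_dom a" "0 \<le> s" "s \<le> S"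
  shows "\<tau> * s \<in> radial_dom a"
proof (cases "\<tau> \<ge> 0")
  case True
  with assms show ?thesis by (intro radial_dom_down[OF assms(1)] mult_left_mono)
next
  case False
  with assms(2) show ?thesis by (intro radial_dom_nonpos) (simp add: mult_nonpos_nonneg)
qed

lemma radial_pos: "z \<in> radial_dom a \<Longrightarrow> radial a z > 0"
  by (auto simp: radial_dom_def)

lemma open_radial_dom: "open (radial_dom a)"
proof (rule openI)
  fix z assume z: "z \<in> radial_dom a"
  have "continuous_on UNIV (radial a :: real \<Rightarrow> real)"
    using a by (intro continuous_intros)
  then have "open {y :: real. radial a y > 0}"
    by (intro open_Collect_less continuous_on_const)
  moreover have "z \<in> {y. radial a y > 0}" using radial_pos[OF z] by simp
  ultimately obtain e where e: "e > 0" "ball z e \<subseteq> {y. radial a y > 0}"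
    using open_contains_ball by blast
  have "ball z e \<subseteq> radial_dom a"
  proof
    fix w assume w: "w \<in> ball z e"
    have "radial a y > 0" if "y \<le> w" for y
    proof (cases "y \<le> z")
      case True then show ?thesis using z by (simp add: radial_dom_def)
    next
      case False
      then have "y \<in> ball z e" using that w by (simp add: dist_real_def)
      then show ?thesis using e(2) by blast
    qed
    then show "w \<in> radial_dom a" by (simp add: radial_dom_def)
  qed
  with e(1) show "\<exists>T>0. ball z T \<subseteq> radial_dom a" by blast
qed

lemma radial_pos_on_ray:
  fixes z t :: real
  assumes "\<And>y. y < z \<Longrightarrow> radial a y > 0" "0 < t" "t < 1"
  shows "radial a (t * z) > 0"
proof (cases "z > 0")
  case True
  then have "t * z < z" using assms(3) by simp
  then show ?thesis using assms(1) by simp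
next
  case False
  then show ?thesis using assms by (intro radial_pos_of_nonpos[OF a]) (simp add: mult_nonneg_nonpos)
qed

text \<open>
  $-\varphi'$ satisfies $a(-\varphi') + y(-\varphi')' = \varphi/4$.
  Positivity is assumed only to the left of \<open>z\<close> so that the lemma also applies at the
  first zero itself.
\<close>

lemma radial'_neg:
  fixes z :: real
  assumes "\<And>y. y < z \<Longrightarrow> radial a y > 0"
  shows "radial' a z < 0"
proof -
  have "- radial' a z > 0"
  proof (rule euler_operator_pos[where a = a and X = "\<lambda>y. - radial' a y" and X' = "\<lambda>y. - radial'' a y"])
    show "((\<lambda>y. - radial' a y) has_real_derivative - radial'' a y) (at y)" for y
      by (intro DERIV_minus DERIV_radial' a)
    show "a * - radial' a (t * z) + t * z * - radial'' a (t * z) > 0" if "0 < t" "t < 1" for t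
      using radial_ode[OF a, of "t * z"] radial_pos_on_ray[OF assms that] by simp
  qed (use a in auto)
  then show ?thesis by simp
qed

lemma radial_strict_antimono:
  assumes "z \<in> radial_dom a" "y < z"
  shows "radial a z < radial a y"
proof (rule DERIV_neg_imp_decreasing[OF assms(2)])
  fix x assume "y \<le> x" "x \<le> z"
  then have "\<And>y. y < x \<Longrightarrow> radial a y > 0"
    using assms by (auto simp: radial_dom_def)
  then show "\<exists>y. (radial a has_real_derivative y) (at x) \<and> y < 0"
    using DERIV_radial[OF a, of x] radial'_neg by blast
qed

text \<open>
  The slope $F$ satisfies $aF + yF' = \varphi^2/2$. In integrated form this is the classical formula
  that the derivative of the Robin constant with respect to the eigenvalue is
  $\int u^2$ over the ball divided by $\int u^2$ over the sphere.
\<close>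

lemma robin_slope_pos:
  assumes "z \<in> radial_dom a"
  shows "robin_slope a z > 0"
proof -
  let ?p = "radial a :: real \<Rightarrow> real" and ?p' = "radial' a :: real \<Rightarrow> real"
    and ?p'' = "radial'' a :: real \<Rightarrow> real"
  let ?F' = "\<lambda>y. 2 * (a - 1) * (?p' y * ?p' y + ?p y * ?p'' y) + ?p y * ?p' y +
     2 * (?p' y)\<^sup>2 + 4 * y * ?p' y * ?p'' y"
  show ?thesis
  proof (rule euler_operator_pos[where a = a and X = "robin_slope a" and X' = ?F'])
    show "(robin_slope a has_real_derivative ?F' y) (at y)" for y
      unfolding robin_slope_def[abs_def] using a
      by (auto intro!: derivative_eq_intros simp: algebra_simps power2_eq_square)
    show "a * robin_slope a (t * z) + t * z * ?F' (t * z) > 0" if t: "0 < t" "t < 1" for t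
    proof -
      define y where "y = t * z"
      have "y * ?F' y = 2 * (a - 1) * (y * (?p' y)\<^sup>2 + ?p y * (y * ?p'' y)) + y * ?p y * ?p' y +
          2 * y * (?p' y)\<^sup>2 + 4 * y * ?p' y * (y * ?p'' y)"
        by (simp add: algebra_simps power2_eq_square)
      then have "a * robin_slope a y + y * ?F' y = (?p y)\<^sup>2 / 2"
        unfolding radial_ode[OF a] robin_slope_def
        by (simp add: field_simps power2_eq_square)
      moreover have "(?p y)\<^sup>2 / 2 > 0"
      proof -
        have "?p y > 0"
        using radial_pos_on_ray[OF _ t, of z] assms by (auto simp: y_def radial_dom_def)
        then show ?thesis by simp
      qed
      ultimately show ?thesis by (simp only: y_def)
    qed
  qed (use a in auto)
qed

lemma robin_quot_strict_mono:
  assumes "z \<in> radial_dom a" "y < z"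
  shows "robin_quot a y < robin_quot a z"
proof (rule DERIV_pos_imp_increasing[OF assms(2)])
  fix x assume "y \<le> x" "x \<le> z"
  then have x: "x \<in> radial_dom a" using assms radial_dom_down by blast
  then have "radial a x > 0" by (rule radial_pos)
  with x show "\<exists>y. (robin_quot a has_real_derivative y) (at x) \<and> y > 0"
    using DERIV_robin_quot[OF a, of x] robin_slope_pos[OF x] by fastforce
qed

text \<open>
  Since $\varphi$ decreases, $-\varphi'$ exceeds the constant $\varphi(z)/(4a)$ at \<open>z\<close>, because
  $a(-\varphi') + y(-\varphi')' = \varphi(y)/4 > \varphi(z)/4$ before \<open>z\<close>. The linear lower bound makes
  \<open>robin_quot\<close> reach every positive value, whether or not a first zero exists.
\<close>

lemma robin_quot_ge:
  assumes z: "z \<in> radial_dom a" "0 < z"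
  shows "z / (2 * a) \<le> robin_quot a z"
proof -
  define m where "m = radial a z"
  have m: "m > 0" using radial_pos[OF z(1)] by (simp add: m_def)
  have "- radial' a z - m / (4 * a) > 0"
  proof (rule euler_operator_pos[where a = a and X = "\<lambda>y. - radial' a y - m / (4 * a)"
        and X' = "\<lambda>y. - radial'' a y"])
    show "((\<lambda>y. - radial' a y - m / (4 * a)) has_real_derivative - radial'' a y) (at y)" for y
      using a by (auto intro!: derivative_eq_intros)
    show "a * (- radial' a (t * z) - m / (4 * a)) + t * z * - radial'' a (t * z) > 0"
      if "0 < t" "t < 1" for t
    proof -
      have "t * z < 1 * z" using that z by (intro mult_strict_right_mono) auto
      then have "radial a (t * z) > m"
        using radial_strict_antimono[OF z(1)] by (simp add: m_def)
      then show ?thesis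
        using radial_ode[OF a, of "t * z"] a by (simp add: algebra_simps)
    qed
  qed (use a in auto)
  then have "2 * z * (m / (4 * a)) \<le> 2 * z * - radial' a z"
    using z by (intro mult_left_mono) auto
  then show ?thesis
    using m a unfolding robin_quot_def m_def[symmetric] by (simp add: field_simps)
qed

lemma robin_quot_eq_iff:
  assumes "z \<in> radial_dom a"
  shows "robin_quot a z = b \<longleftrightarrow> 2 * z * radial' a z + b * radial a z = 0"
  using radial_pos[OF assms] by (auto simp: robin_quot_def field_simps)

text \<open>
  The boundary expression $h = 2z\varphi' + b\varphi$ is nonnegative at $0$. It is negative either
  at $2ab + 1$, by the linear lower bound, or at an earlier first zero of $\varphi$, where only
  the term with $\varphi' < 0$ is left. In both cases its zero in between lies in the domain.
\<close>

lemma robin_quot_attains_nonneg: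
  assumes b: "0 \<le> b"
  shows "\<exists>z\<in>radial_dom a. robin_quot a z = b"
proof -
  define h where "h = (\<lambda>z. 2 * z * radial' a z + b * radial a z :: real)"
  have cont: "continuous_on S h" for S
    unfolding h_def using a by (intro continuous_intros)
  have h0: "h 0 \<ge> 0" using b by (simp add: h_def)
  define Z where "Z = 2 * a * b + 1"
  have Z: "Z > 0" using a b by (simp add: Z_def add_nonneg_pos)
  have "\<exists>w>0. (\<forall>y<w. radial a (y :: real) > 0) \<and> h w < 0"
  proof (cases "Z \<in> radial_dom a")
    case True
    have "b < Z / (2 * a)" using a by (simp add: Z_def field_simps)
    also have "\<dots> \<le> robin_quot a Z" using robin_quot_ge[OF True Z] .
    finally have "h Z < 0"
      using radial_pos[OF True] by (simp add: h_def robin_quot_def field_simps)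
    with True Z show ?thesis by (auto simp: radial_dom_def)
  next
    case False
    let ?S = "{0..Z} \<inter> {y. radial a y \<le> 0}"
    have "continuous_on UNIV (radial a :: real \<Rightarrow> real)"
      using a by (intro continuous_intros)
    then have "closed {y :: real. radial a y \<le> 0}"
      by (intro closed_Collect_le continuous_on_const)
    then have "compact ?S" by (intro compact_Int_closed) auto
    moreover have "?S \<noteq> {}"
    proof -
      obtain y where "y \<le> Z" "radial a y \<le> 0" using False by (force simp: radial_dom_def)
      moreover from this have "0 \<le> y" using radial_pos_of_nonpos[OF a, of y] by force
      ultimately show ?thesis by auto
    qed
    ultimately obtain j where j: "j \<in> ?S" "\<And>y. y \<in> ?S \<Longrightarrow> j \<le> y"
      using compact_attains_inf by metis
    have jpos: "j > 0" using j(1) by (cases "j = 0") auto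
    have less: "radial a y > 0" if "y < j" for y
    proof (rule ccontr)
      assume "\<not> ?thesis"
      then have "y \<in> ?S" using that j(1) radial_pos_of_nonpos[OF a, of y] by force
      then show False using j(2) that by force
    qed
    have "radial' a j < 0" using radial'_neg[OF less] .
    then have "2 * j * radial' a j < 0" using jpos by (simp add: mult_pos_neg)
    moreover have "b * radial a j \<le> 0" using j(1) b by (simp add: mult_nonneg_nonpos)
    ultimately have "h j < 0" by (simp add: h_def)
    then show ?thesis using jpos less by blast
  qed
  then obtain w where w: "w > 0" "\<And>y. y < w \<Longrightarrow> radial a y > 0" "h w < 0" by blast
  obtain z where z: "0 \<le> z" "z \<le> w" "h z = 0"
    using IVT2'[of h w 0 0] w h0 cont by auto
  with w(3) have "z < w" by (cases "z = w") auto
  then have "z \<in> radial_dom a" using w(2) by (auto simp: radial_dom_def)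
  with z(3) show ?thesis using robin_quot_eq_iff by (auto simp: h_def)
qed

text \<open>
  If the boundary expression stayed negative on the whole negative half-line, the logarithmic
  derivative of $\varphi(-y)$ would be at most $K/y$, so $\varphi(-y)$ would grow at most like $y^K$;
  but it outgrows every power.
\<close>

lemma robin_quot_attains_neg:
  assumes b: "b < 0"
  shows "\<exists>z\<in>radial_dom a. robin_quot a z = b"
proof -
  define h where "h = (\<lambda>z. 2 * z * radial' a z + b * radial a z :: real)"
  have cont: "continuous_on S h" for S
    unfolding h_def using a by (intro continuous_intros)
  have h0: "h 0 \<le> 0" using b by (simp add: h_def)
  have "\<exists>w<0. h w \<ge> 0"
  proof (rule ccontr)
    assume "\<not> ?thesis"
    then have neg: "\<And>w. w < 0 \<Longrightarrow> h w < 0" by force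
    obtain K :: nat where K: "- b / 2 \<le> real K" using real_arch_simple by blast
    obtain c where c: "c > 0" "\<And>y. y \<ge> 0 \<Longrightarrow> c * y ^ Suc K \<le> radial a (- y :: real)"
      using radial_pos_growth[OF a] by metis
    define M where "M = radial a (-1 :: real)"
    define y where "y = M / c + 2"
    have M: "M > 0" unfolding M_def by (rule radial_pos_of_nonpos[OF a]) simp
    have y1: "y > 1" using M c by (simp add: y_def add_pos_pos less_imp_le add_nonneg_pos)
    have "radial a (- y) / y ^ K \<le> radial a (- 1) / 1 ^ K"
    proof (rule DERIV_nonpos_imp_nonincreasing[where f = "\<lambda>y. radial a (- y) / y ^ K"])
      show "1 \<le> y" using y1 by simp
      fix x :: real assume x: "1 \<le> x" "x \<le> y"
      have "2 * (- x) * radial' a (- x) < - b * radial a (- x)"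
        using neg[of "- x"] x by (simp add: h_def)
      also have "\<dots> \<le> (2 * real K) * radial a (- x)"
        using K radial_pos_of_nonpos[OF a, of "- x"] x by (intro mult_right_mono) auto
      finally have le: "- x * radial' a (- x) - real K * radial a (- x) \<le> 0" by simp
      have "((\<lambda>x. radial a (- x) / x ^ K) has_real_derivative
          (- radial' a (- x) * x ^ K - radial a (- x) * (real K * x ^ (K - 1))) / (x ^ K * x ^ K)) (at x)"
        using x a by (auto intro!: derivative_eq_intros)
      also have "real K * x ^ (K - 1) = real K * x ^ K / x"
        using x by (cases K) auto
      also have "- radial' a (- x) * x ^ K - radial a (- x) * (real K * x ^ K / x) =
          (- x * radial' a (- x) - real K * radial a (- x)) * (x ^ K / x)"
        using x by (simp add: field_simps)
      finally have "((\<lambda>x. radial a (- x) / x ^ K) has_real_derivative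
          (- x * radial' a (- x) - real K * radial a (- x)) * (x ^ K / x) / (x ^ K * x ^ K)) (at x)" .
      moreover have "(- x * radial' a (- x) - real K * radial a (- x)) * (x ^ K / x) /
          (x ^ K * x ^ K) \<le> 0"
        using le x by (intro divide_nonpos_pos mult_nonpos_nonneg) auto
      ultimately show "\<exists>D. ((\<lambda>x. radial a (- x) / x ^ K) has_real_derivative D) (at x) \<and> D \<le> 0"
        by blast
    qed
    then have "radial a (- y) \<le> M * y ^ K"
      using y1 by (simp add: M_def field_simps)
    moreover have "c * y * y ^ K \<le> radial a (- y)"
      using c(2)[of y] y1 by (simp add: mult.assoc)
    ultimately have "c * y * y ^ K \<le> M * y ^ K" by linarith
    then have "c * y \<le> M" using y1 by simp
    moreover have "c * y = M + 2 * c" using c(1) by (simp add: y_def field_simps)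
    ultimately show False using c(1) by simp
  qed
  then obtain w where w: "w < 0" "h w \<ge> 0" by blast
  obtain z where z: "w \<le> z" "z \<le> 0" "h z = 0"
    using IVT2'[of h 0 0 w] w h0 cont by auto
  then have "z \<in> radial_dom a" using radial_dom_nonpos by blast
  with z(3) show ?thesis using robin_quot_eq_iff by (auto simp: h_def)
qed

lemma robin_quot_bij: "bij_betw (robin_quot a) (radial_dom a) UNIV"
proof (rule bij_betwI')
  show "robin_quot a x = robin_quot a y \<longleftrightarrow> x = y" if "x \<in> radial_dom a" "y \<in> radial_dom a" for x y
    using robin_quot_strict_mono[OF that(1), of y] robin_quot_strict_mono[OF that(2), of x]
    by (cases x y rule: linorder_cases) auto
  show "\<exists>x\<in>radial_dom a. b = robin_quot a x" for b
    using robin_quot_attains_nonneg[of b] robin_quot_attains_neg[of b] by (cases "b \<ge> 0") force+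
qed simp

definition robin_inv :: "real \<Rightarrow> real" where
  "robin_inv = the_inv_into (radial_dom a) (robin_quot a)"

lemma robin_inv_in_dom: "robin_inv b \<in> radial_dom a"
  using robin_quot_bij unfolding robin_inv_def
  by (intro the_inv_into_into[OF bij_betw_imp_inj_on]) (auto simp: bij_betw_def)

lemma robin_quot_inv: "robin_quot a (robin_inv b) = b"
  using robin_quot_bij unfolding robin_inv_def
  by (intro f_the_inv_into_f_bij_betw) auto

lemma robin_inv_quot: "z \<in> radial_dom a \<Longrightarrow> robin_inv (robin_quot a z) = z"
  using robin_quot_bij unfolding robin_inv_def
  by (intro the_inv_into_f_f) (auto simp: bij_betw_def)

lemma robin_inv_eqI: "z \<in> radial_dom a \<Longrightarrow> robin_quot a z = b \<Longrightarrow> robin_inv b = z"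
  using robin_inv_quot by blast

end

section \<open>Analyticity of the inverse\<close>

lemma robin_inv_continuous:
  assumes a: "1 \<le> a" and e: "e > 0"
  shows "\<exists>d>0. \<forall>w. \<bar>w - b\<bar> < d \<longrightarrow> \<bar>robin_inv a w - robin_inv a b\<bar> < e"
proof -
  define z where "z = robin_inv a b"
  have z: "z \<in> radial_dom a" "robin_quot a z = b"
    using robin_inv_in_dom[OF a] robin_quot_inv[OF a] by (auto simp: z_def)
  obtain r where r: "r > 0" "ball z r \<subseteq> radial_dom a"
    using open_contains_ball[THEN iffD1, OF open_radial_dom[OF a]] z(1) by blast
  define s where "s = min e r / 2"
  have s: "0 < s" "s < e" "s < r" using e r by (auto simp: s_def)
  have dom: "z + s \<in> radial_dom a" "z - s \<in> radial_dom a"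
    using r(2) s by (auto simp: dist_real_def subset_iff)
  have lt: "robin_quot a (z - s) < b" "b < robin_quot a (z + s)"
    using robin_quot_strict_mono[OF a z(1), of "z - s"] robin_quot_strict_mono[OF a dom(1), of z] s z
    by auto
  define d where "d = min (b - robin_quot a (z - s)) (robin_quot a (z + s) - b)"
  have "\<bar>robin_inv a w - z\<bar> < e" if w: "\<bar>w - b\<bar> < d" for w
  proof -
    let ?y = "robin_inv a w"
    have y: "?y \<in> radial_dom a" "robin_quot a ?y = w"
      using robin_inv_in_dom[OF a] robin_quot_inv[OF a] by auto
    have "robin_quot a (z - s) < w" "w < robin_quot a (z + s)"
      using w by (auto simp: d_def)
    then have "z - s < ?y" "?y < z + s"
      using robin_quot_strict_mono[OF a dom(2), of ?y] robin_quot_strict_mono[OF a y(1), of "z + s"] y(2)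
      by (cases ?y "z - s" rule: linorder_cases; cases ?y "z + s" rule: linorder_cases; auto)+
    then show ?thesis using s by simp
  qed
  moreover have "d > 0" using lt by (simp add: d_def)
  ultimately show ?thesis unfolding z_def by blast
qed

text \<open>
  \<open>robin_quot a\<close> extends holomorphically to a complex neighbourhood of every point of the domain,
  with nonzero derivative there, so it has a local holomorphic inverse. On the real axis this
  inverse is \<open>robin_inv a\<close>; continuity of \<open>robin_inv a\<close> ensures that its values stay in the
  neighbourhood on which the holomorphic inverse is defined.
\<close>

theorem robin_inv_analytic:
  assumes a: "1 \<le> a"
  shows "real_analytic_on (robin_inv a) UNIV"
  unfolding real_analytic_on_def
proof
  fix b :: real
  define z where "z = robin_inv a b"
  have z: "z \<in> radial_dom a" "robin_quot a z = b"
    using robin_inv_in_dom[OF a] robin_quot_inv[OF a] by (auto simp: z_def)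
  define S where "S = {w :: complex. radial a w \<noteq> 0}"
  have S: "open S"
  proof -
    have "continuous_on UNIV (radial a :: complex \<Rightarrow> complex)"
      using a by (intro continuous_intros) auto
    then show ?thesis unfolding S_def
      by (intro open_Collect_neq) auto
  qed
  have real: "radial a (of_real x) = (of_real (radial a x) :: complex)"
    "robin_quot a (of_real x) = (of_real (robin_quot a x) :: complex)"
    "robin_slope a (of_real x) = (of_real (robin_slope a x) :: complex)" for x
    using a by (simp_all add: radial_of_real radial'_of_real robin_quot_def robin_slope_def)
  have inS: "of_real x \<in> S" if "x \<in> radial_dom a" for x
    using radial_pos[OF a that] by (simp add: S_def real)
  have deriv: "(robin_quot a has_field_derivative robin_slope a w / (radial a w)\<^sup>2) (at w)"
    if "w \<in> S" for w
    using that a by (intro DERIV_robin_quot) (auto simp: S_def)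
  have holo: "robin_quot a holomorphic_on S"
    using deriv S by (auto simp: holomorphic_on_open)
  have "deriv (robin_quot a) (of_real z) \<noteq> (0 :: complex)"
  proof -
    have "deriv (robin_quot a) (of_real z :: complex) =
        of_real (robin_slope a z / (radial a z)\<^sup>2)"
      using DERIV_imp_deriv[OF deriv[OF inS[OF z(1)]]] by (simp add: real)
    moreover have "robin_slope a z / (radial a z)\<^sup>2 > 0"
      using robin_slope_pos[OF a z(1)] radial_pos[OF a z(1)] by simp
    ultimately show ?thesis by (metis less_irrefl of_real_eq_0_iff)
  qed
  then obtain r where r: "r > 0" "ball (of_real z) r \<subseteq> S" "inj_on (robin_quot a) (ball (of_real z :: complex) r)"
    using has_complex_derivative_locally_injective[OF holo inS[OF z(1)] S] by blast
  define T where "T = ball (of_real z :: complex) r"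
  have holoT: "robin_quot a holomorphic_on T"
    using holomorphic_on_subset[OF holo] r(2) by (simp add: T_def)
  have openT: "open T" and injT: "inj_on (robin_quot a) T"
    using r(3) by (simp_all add: T_def)
  have "\<exists>g. g holomorphic_on (robin_quot a ` T) \<and> (\<forall>w\<in>T. g (robin_quot a w) = w)"
    by (rule holomorphic_has_inverse[OF holoT openT injT]) blast
  then obtain g where g: "g holomorphic_on (robin_quot a ` T)" "\<And>w. w \<in> T \<Longrightarrow> g (robin_quot a w) = w"
    by blast
  have "open (robin_quot a ` T)"
    by (rule open_mapping_thm3[OF holoT openT injT])
  moreover have "of_real b \<in> robin_quot a ` T"
  proof (rule image_eqI)
    show "of_real b = robin_quot a (of_real z :: complex)" using z(2) by (simp add: real)
    show "of_real z \<in> T" using r(1) by (simp add: T_def)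
  qed
  ultimately have "\<exists>R>0. ball (of_real b) R \<subseteq> robin_quot a ` T"
    by (simp only: open_contains_ball)
  then obtain R where R: "R > 0" "ball (of_real b) R \<subseteq> robin_quot a ` T" by blast
  obtain d where d: "d > 0" "\<And>w. \<bar>w - b\<bar> < d \<Longrightarrow> \<bar>robin_inv a w - z\<bar> < r"
    using robin_inv_continuous[OF a r(1), of b] unfolding z_def by blast
  define c where "c = (\<lambda>n. (deriv ^^ n) g (of_real b) / fact n)"
  \<comment> \<open>The function is real on the real axis, so the real parts of the Taylor coefficients represent it.\<close>
  have sums: "(\<lambda>n. Re (c n) * (x - b) ^ n) sums robin_inv a x" if x: "\<bar>x - b\<bar> < min R d" for x
  proof -
    have "of_real (robin_inv a x) \<in> T"
      using d(2)[of x] x by (simp add: T_def dist_real_def abs_minus_commute)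
    from g(2)[OF this] have gx: "g (of_real x) = of_real (robin_inv a x)"
      by (simp add: real robin_quot_inv[OF a])
    have "(\<lambda>n. c n * (of_real x - of_real b) ^ n) sums g (of_real x)"
      unfolding c_def
    proof (rule holomorphic_power_series)
      show "g holomorphic_on ball (of_real b) R" using g(1) R(2) by (rule holomorphic_on_subset)
      show "of_real x \<in> ball (of_real b :: complex) R"
        using x by (simp add: dist_real_def abs_minus_commute)
    qed
    from sums_Re[OF this] show ?thesis
      by (simp add: gx flip: of_real_diff of_real_power)
  qed
  show "\<exists>r>0. \<exists>c. \<forall>x. \<bar>x - b\<bar> < r \<longrightarrow> (\<lambda>n. c n * (x - b) ^ n) sums robin_inv a x"
  proof (intro exI conjI allI impI)
    show "min R d > 0" using R(1) d(1) by simp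
  qed (rule sums)
qed

lemma real_analytic_onD:
  "real_analytic_on f S \<Longrightarrow> x0 \<in> S \<Longrightarrow>
    \<exists>r>0. \<exists>a. \<forall>x. \<bar>x - x0\<bar> < r \<longrightarrow> (\<lambda>n. a n * (x - x0) ^ n) sums f x"
  by (simp add: real_analytic_on_def)

lemma real_analytic_on_scale:
  assumes f: "real_analytic_on f UNIV" and k: "k \<noteq> 0"
  shows "real_analytic_on (\<lambda>x. f (k * x)) UNIV"
  unfolding real_analytic_on_def
proof
  fix x0
  obtain r c where r: "r > 0" "\<And>x. \<bar>x - k * x0\<bar> < r \<Longrightarrow> (\<lambda>n. c n * (x - k * x0) ^ n) sums f x"
    using f unfolding real_analytic_on_def by (meson UNIV_I)
  have sums: "(\<lambda>n. (c n * k ^ n) * (x - x0) ^ n) sums f (k * x)" if "\<bar>x - x0\<bar> < r / \<bar>k\<bar>" for x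
  proof -
    have eq: "k * x - k * x0 = k * (x - x0)" by (simp add: algebra_simps)
    have "\<bar>k * x - k * x0\<bar> < r"
      unfolding eq abs_mult using that k by (simp add: pos_less_divide_eq mult.commute)
    from r(2)[OF this] show ?thesis by (simp add: eq power_mult_distrib mult.assoc)
  qed
  show "\<exists>r>0. \<exists>a. \<forall>x. \<bar>x - x0\<bar> < r \<longrightarrow> (\<lambda>n. a n * (x - x0) ^ n) sums f (k * x)"
  proof (intro exI conjI allI impI)
    show "r / \<bar>k\<bar> > 0" using r(1) k by simp
  qed (rule sums)
qed

text \<open>
  The limit is the second Taylor coefficient. Both error estimates of the final theorem are
  boundedness of this one quotient.
\<close>

lemma real_analytic_at_0_quadratic_remainder:
  assumes f: "real_analytic_on f UNIV" and f0: "f 0 = 0" and f': "(f has_real_derivative D) (at 0)"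
  shows "\<exists>L. ((\<lambda>x. (f x - D * x) / x\<^sup>2) \<longlongrightarrow> L) (at 0)"
proof -
  have "\<exists>r>0. \<exists>c. \<forall>x. \<bar>x - 0\<bar> < r \<longrightarrow> (\<lambda>n. c n * (x - 0) ^ n) sums f x"
    by (rule real_analytic_onD[OF f UNIV_I])
  then obtain r c where r: "r > 0"
    and all: "\<forall>x. \<bar>x - 0\<bar> < r \<longrightarrow> (\<lambda>n. c n * (x - 0) ^ n) sums f x"
    by (elim exE conjE) (rule that)
  have sums: "(\<lambda>n. c n * x ^ n) sums f x" if "\<bar>x\<bar> < r" for x
    using all[rule_format, of x] that by simp
  have c0: "c 0 = 0" using sums[of 0] r f0 by (simp add: sums_iff)
  define g where "g = (\<lambda>x. \<Sum>n. c (n + 2) * x ^ n)"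
  have S: "summable (\<lambda>n. c n * x ^ n)" if "\<bar>x\<bar> < r" for x
    using sums[OF that] by (simp add: sums_iff)
  have S2: "summable (\<lambda>n. c (n + 2) * x ^ n)" if "\<bar>x\<bar> < r" for x
    using powser_split_head(3)[OF powser_split_head(3)[OF S[OF that]]] by simp
  have fx: "f x = c 1 * x + x\<^sup>2 * g x" if "\<bar>x\<bar> < r" for x
  proof -
    have "f x = (\<Sum>n. c n * x ^ n)" using sums[OF that] by (simp add: sums_iff)
    also have "\<dots> = c 0 + (c 1 + g x * x) * x"
      using powser_split_head(1)[OF S[OF that]]
        powser_split_head(1)[OF powser_split_head(3)[OF S[OF that]]]
      by (simp add: g_def)
    finally show ?thesis using c0 by (simp add: algebra_simps power2_eq_square)
  qed
  have "isCont g 0"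
    unfolding g_def using r by (intro isCont_powser[OF S2[of "r / 2"]]) auto
  then have g: "(g \<longlongrightarrow> g 0) (at 0)" by (simp add: isCont_def)
  have near: "eventually (\<lambda>x. \<bar>x\<bar> < r \<and> x \<noteq> 0) (at 0)"
    unfolding eventually_at using r by (intro exI[of _ r]) (auto simp: dist_real_def)
  have "((\<lambda>x. c 1 + x * g x) \<longlongrightarrow> c 1 + 0 * g 0) (at 0)"
    by (intro tendsto_intros g)
  moreover have "eventually (\<lambda>x. c 1 + x * g x = f x / x) (at 0)"
    using near by eventually_elim (simp add: fx field_simps power2_eq_square)
  ultimately have "((\<lambda>x. f x / x) \<longlongrightarrow> c 1) (at 0)"
    by (simp add: filterlim_cong)
  moreover have "((\<lambda>x. f x / x) \<longlongrightarrow> D) (at 0)"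
    using f' f0 by (simp add: has_field_derivative_iff)
  ultimately have D: "D = c 1" by (meson LIM_unique)
  have "eventually (\<lambda>x. g x = (f x - D * x) / x\<^sup>2) (at 0)"
    using near by eventually_elim (simp add: fx D)
  with g have "((\<lambda>x. (f x - D * x) / x\<^sup>2) \<longlongrightarrow> g 0) (at 0)"
    by (simp add: filterlim_cong)
  then show ?thesis by blast
qed

lemma robin_inv_0: "1 \<le> a \<Longrightarrow> robin_inv a 0 = 0"
  by (rule robin_inv_eqI[of a 0 0]) (simp_all add: radial_dom_nonpos robin_quot_def)

lemma DERIV_robin_inv_0:
  assumes a: "1 \<le> a"
  shows "(robin_inv a has_real_derivative 2 * a) (at 0)"
proof -
  have deriv: "(robin_quot a has_real_derivative 1 / (2 * a)) (at (robin_inv a 0))"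
  proof -
    have "robin_slope a 0 / (radial a 0)\<^sup>2 = 1 / (2 * a)"
    proof -
      have "radial' a 0 = - 1 / (4 * a)" by (simp add: radial'_def)
      then have "robin_slope a 0 = 2 * (a - 1) * (- 1 / (4 * a)) + 1 / 2" by (simp add: robin_slope_def)
      also have "\<dots> = 1 / (2 * a)" using a by (simp add: divide_simps)
      finally show ?thesis by simp
    qed
    moreover have "(robin_quot a has_real_derivative robin_slope a 0 / (radial a 0)\<^sup>2) (at 0)"
      using a by (intro DERIV_robin_quot) auto
    ultimately show ?thesis using robin_inv_0[OF a] by simp
  qed
  have "isCont (robin_inv a) 0"
    unfolding isCont_def LIM_eq
  proof (intro allI impI)
    fix e :: real assume "e > 0"
    then obtain d where "d > 0" "\<And>w. \<bar>w - 0\<bar> < d \<Longrightarrow> \<bar>robin_inv a w - robin_inv a 0\<bar> < e"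
      using robin_inv_continuous[OF a, of e 0] by blast
    then show "\<exists>s>0. \<forall>x. x \<noteq> 0 \<and> norm (x - 0) < s \<longrightarrow> norm (robin_inv a x - robin_inv a 0) < e"
      by (intro exI[of _ d]) simp
  qed
  then have "(robin_inv a has_real_derivative inverse (1 / (2 * a))) (at 0)"
    using a robin_quot_inv[OF a]
    by (intro has_field_derivative_inverse_basic[where f = "robin_quot a" and g = "robin_inv a" and y = 0
          and t = UNIV, OF deriv]) auto
  then show ?thesis by simp
qed

section \<open>The maximum principle for Robin solutions\<close>

lemma second_derivative_nonneg_at_min:
  fixes g :: "real \<Rightarrow> real"
  assumes e: "e > 0" and g: "\<And>t. \<bar>t\<bar> < e \<Longrightarrow> (g has_real_derivative g' t) (at t)"
    and g': "(g' has_real_derivative D) (at 0)"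
    and min: "\<And>t. \<bar>t\<bar> < e \<Longrightarrow> g 0 \<le> g t"
  shows "0 \<le> D"
proof (rule ccontr)
  assume "\<not> 0 \<le> D"
  have "g' 0 = 0"
    using DERIV_local_min[OF g[of 0] e] e min by auto
  then obtain d where d: "d > 0" "\<And>h. 0 < h \<Longrightarrow> h < d \<Longrightarrow> g' h < 0"
    using DERIV_neg_dec_right[OF g'] \<open>\<not> 0 \<le> D\<close> by auto
  define h where "h = min d e / 2"
  have h: "0 < h" "h < d" "h < e" using d e by (auto simp: h_def)
  have "g h < g 0"
  proof (rule DERIV_neg_imp_decreasing_open[of 0 h g])
    show "continuous_on {0..h} g"
      by (rule DERIV_continuous_on, rule has_field_derivative_at_within, rule g) (use h in auto)
    show "\<exists>y. (g has_real_derivative y) (at x) \<and> y < 0" if "0 < x" "x < h" for x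
    proof (intro exI conjI)
      show "(g has_real_derivative g' x) (at x)" using that h by (intro g) simp
      show "g' x < 0" using that h by (intro d(2)) simp_all
    qed
  qed (fact h)
  with min[of h] h show False by simp
qed

text \<open>
  Names the gradient and the Hessian of a solution, so that the conditions on them can be quoted
  one by one.
\<close>

definition robin_witness ::
  "real \<Rightarrow> real \<Rightarrow> real \<Rightarrow> ('a::euclidean_space \<Rightarrow> real) \<Rightarrow> ('a \<Rightarrow> 'a) \<Rightarrow> ('a \<Rightarrow> 'a \<Rightarrow>\<^sub>L 'a) \<Rightarrow> bool" where
  "robin_witness b \<rho> \<sigma> u G H \<longleftrightarrow>
       (\<forall>x\<in>cball 0 \<rho>. (u has_derivative (\<lambda>h. G x \<bullet> h)) (at x within cball 0 \<rho>)) \<and>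
       continuous_on (cball 0 \<rho>) G \<and>
       (\<forall>x\<in>ball 0 \<rho>. (G has_derivative blinfun_apply (H x)) (at x)) \<and>
       continuous_on (ball 0 \<rho>) H \<and>
       (\<forall>x\<in>ball 0 \<rho>. - (\<Sum>i\<in>Basis. blinfun_apply (H x) i \<bullet> i) = \<sigma> * u x) \<and>
       (\<forall>x\<in>sphere 0 \<rho>. G x \<bullet> (x /\<^sub>R \<rho>) + b * u x = 0)"

lemma robin_solution_iff_witness:
  "robin_solution b \<rho> \<sigma> u \<longleftrightarrow> (\<exists>G H. robin_witness b \<rho> \<sigma> u G H)"
  unfolding robin_solution_def robin_witness_def ..

lemma robin_witnessD:
  assumes "robin_witness b \<rho> \<sigma> u G H"
  shows "x \<in> cball 0 \<rho> \<Longrightarrow> (u has_derivative (\<lambda>h. G x \<bullet> h)) (at x within cball 0 \<rho>)"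
    and "continuous_on (cball 0 \<rho>) G"
    and "x \<in> ball 0 \<rho> \<Longrightarrow> (G has_derivative blinfun_apply (H x)) (at x)"
    and "continuous_on (ball 0 \<rho>) H"
    and "x \<in> ball 0 \<rho> \<Longrightarrow> - (\<Sum>i\<in>Basis. blinfun_apply (H x) i \<bullet> i) = \<sigma> * u x"
    and "x \<in> sphere 0 \<rho> \<Longrightarrow> G x \<bullet> (x /\<^sub>R \<rho>) + b * u x = 0"
  subgoal by (rule assms[unfolded robin_witness_def, THEN conjunct1, THEN bspec])
  subgoal by (rule assms[unfolded robin_witness_def, THEN conjunct2, THEN conjunct1])
  subgoal by (rule assms[unfolded robin_witness_def, THEN conjunct2, THEN conjunct2, THEN conjunct1, THEN bspec])
  subgoal by (rule assms[unfolded robin_witness_def, THEN conjunct2, THEN conjunct2, THEN conjunct2, THEN conjunct1])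
  subgoal by (rule assms[unfolded robin_witness_def, THEN conjunct2, THEN conjunct2, THEN conjunct2,
        THEN conjunct2, THEN conjunct1, THEN bspec])
  subgoal by (rule assms[unfolded robin_witness_def, THEN conjunct2, THEN conjunct2, THEN conjunct2,
        THEN conjunct2, THEN conjunct2, THEN bspec])
  done

lemma robin_solution_uminus:
  assumes "robin_solution b \<rho> \<sigma> u"
  shows "robin_solution b \<rho> \<sigma> (\<lambda>x. - u x)"
proof -
  obtain G H where GH: "robin_witness b \<rho> \<sigma> u G H"
    using assms unfolding robin_solution_iff_witness by blast
  note * = robin_witnessD[OF GH]
  have "robin_witness b \<rho> \<sigma> (\<lambda>x. - u x) (\<lambda>x. - G x) (\<lambda>x. - H x)"
    unfolding robin_witness_def
  proof (intro conjI ballI)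
    show "((\<lambda>x. - u x) has_derivative (\<lambda>h. - G x \<bullet> h)) (at x within cball 0 \<rho>)"
      if "x \<in> cball 0 \<rho>" for x
      using has_derivative_minus[OF *(1)[OF that]] by simp
    show "((\<lambda>x. - G x) has_derivative blinfun_apply (- H x)) (at x)" if "x \<in> ball 0 \<rho>" for x
      using has_derivative_minus[OF *(3)[OF that]]
      by (simp add: blinfun.minus_left[abs_def])
    show "- (\<Sum>i\<in>Basis. blinfun_apply (- H x) i \<bullet> i) = \<sigma> * - u x" if "x \<in> ball 0 \<rho>" for x
      using *(5)[OF that] by (simp add: blinfun.minus_left sum_negf)
    show "- G x \<bullet> (x /\<^sub>R \<rho>) + b * - u x = 0" if "x \<in> sphere 0 \<rho>" for x
      using *(6)[OF that] by simp
  qed (intro continuous_on_minus *)+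
  then show ?thesis unfolding robin_solution_iff_witness by blast
qed

lemma robin_solution_continuous:
  assumes "robin_solution b \<rho> \<sigma> u"
  shows "continuous_on (cball 0 \<rho>) u"
proof -
  obtain G H where GH: "robin_witness b \<rho> \<sigma> u G H"
    using assms unfolding robin_solution_iff_witness by blast
  show ?thesis by (rule has_derivative_continuous_on) (rule robin_witnessD(1)[OF GH])
qed

text \<open>
  If the radial function $f(|y|^2)$ touches a solution from below (up to a constant) at an
  interior point, the second derivatives of the difference are nonnegative in every coordinate
  direction. Summing them bounds $\Delta f(|y|^2) = 4|y|^2 f'' + 2Nf'$ by $\Delta u = -\sigma u$.
\<close>

lemma robin_touching_interior:
  fixes u :: "'a::euclidean_space \<Rightarrow> real" and f f' f'' :: "real \<Rightarrow> real"
  assumes u: "robin_solution b \<rho> \<sigma> u" and x: "x \<in> ball 0 \<rho>"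
    and f': "\<And>s. (f has_real_derivative f' s) (at s)"
    and f'': "\<And>s. (f' has_real_derivative f'' s) (at s)"
    and e: "e > 0" and min: "\<And>y. dist x y < e \<Longrightarrow> u x - f (x \<bullet> x) \<le> u y - f (y \<bullet> y)"
  shows "4 * (x \<bullet> x) * f'' (x \<bullet> x) + 2 * DIM('a) * f' (x \<bullet> x) \<le> - \<sigma> * u x"
proof -
  obtain G H where w: "robin_witness b \<rho> \<sigma> u G H"
    using u unfolding robin_solution_iff_witness by blast
  note GH = robin_witnessD(1)[OF w] robin_witnessD(3)[OF w] robin_witnessD(5)[OF w]
  have u': "(u has_derivative (\<lambda>h. G y \<bullet> h)) (at y)" if "y \<in> ball 0 \<rho>" for y
  proof -
    have "y \<in> cball 0 \<rho>" "y \<in> interior (cball 0 \<rho>)" using that by auto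
    then show ?thesis using GH(1)[of y] at_within_interior[of y "cball 0 \<rho>"] by simp
  qed
  obtain e' where e': "e' > 0" "ball x e' \<subseteq> ball 0 \<rho>"
    using x open_contains_ball[THEN iffD1, OF open_ball] by blast
  define r where "r = min e e'"
  have r: "r > 0" using e e' by (simp add: r_def)
  have dir: "4 * (x \<bullet> i)\<^sup>2 * f'' (x \<bullet> x) + 2 * f' (x \<bullet> x) \<le> blinfun_apply (H x) i \<bullet> i"
    if i: "i \<in> Basis" for i
  proof -
    define \<gamma> where "\<gamma> = (\<lambda>t. x + t *\<^sub>R i)"
    define g where "g = (\<lambda>t. u (\<gamma> t) - f (\<gamma> t \<bullet> \<gamma> t))"
    define g' where "g' = (\<lambda>t. G (\<gamma> t) \<bullet> i - f' (\<gamma> t \<bullet> \<gamma> t) * (2 * (\<gamma> t \<bullet> i)))"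
    have near: "dist x (\<gamma> t) < r" if "\<bar>t\<bar> < r" for t
      using that i by (simp add: \<gamma>_def dist_norm)
    have inball: "\<gamma> t \<in> ball 0 \<rho>" if "\<bar>t\<bar> < r" for t
      using near[OF that] e'(2) by (auto simp: r_def)
    have \<gamma>': "(\<gamma> has_derivative (\<lambda>h. h *\<^sub>R i)) (at t)" for t
      unfolding \<gamma>_def by (auto intro!: derivative_eq_intros)
    have sq: "((\<lambda>t. \<gamma> t \<bullet> \<gamma> t) has_real_derivative 2 * (\<gamma> t \<bullet> i)) (at t)" for t
      unfolding has_field_derivative_def
      by (rule has_derivative_eq_rhs[OF has_derivative_inner[OF \<gamma>' \<gamma>']])
         (auto simp: fun_eq_iff inner_commute)
    have "0 \<le> blinfun_apply (H x) i \<bullet> i - (f'' (x \<bullet> x) * (2 * (x \<bullet> i)) * (2 * (x \<bullet> i)) + f' (x \<bullet> x) * 2)"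
    proof (rule second_derivative_nonneg_at_min[OF r, of g g'])
      show "(g has_real_derivative g' t) (at t)" if "\<bar>t\<bar> < r" for t
        unfolding g_def g'_def
      proof (rule DERIV_diff)
        show "((\<lambda>t. u (\<gamma> t)) has_real_derivative G (\<gamma> t) \<bullet> i) (at t)"
          unfolding has_field_derivative_def
          by (rule has_derivative_eq_rhs[OF has_derivative_compose[OF \<gamma>' u'[OF inball[OF that]]]])
             (auto simp: fun_eq_iff)
        show "((\<lambda>t. f (\<gamma> t \<bullet> \<gamma> t)) has_real_derivative f' (\<gamma> t \<bullet> \<gamma> t) * (2 * (\<gamma> t \<bullet> i))) (at t)"
          by (rule DERIV_chain2[OF f' sq])
      qed
      have [simp]: "\<gamma> 0 = x" by (simp add: \<gamma>_def)
      show "(g' has_real_derivative blinfun_apply (H x) i \<bullet> i -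
          (f'' (x \<bullet> x) * (2 * (x \<bullet> i)) * (2 * (x \<bullet> i)) + f' (x \<bullet> x) * 2)) (at 0)"
        unfolding g'_def
      proof (rule DERIV_diff)
        have G': "(G has_derivative blinfun_apply (H x)) (at (\<gamma> 0))" using GH(2)[OF x] by simp
        show "((\<lambda>t. G (\<gamma> t) \<bullet> i) has_real_derivative blinfun_apply (H x) i \<bullet> i) (at 0)"
          unfolding has_field_derivative_def
          by (rule has_derivative_eq_rhs[OF has_derivative_inner_left[OF has_derivative_compose[OF \<gamma>' G']]])
             (auto simp: fun_eq_iff blinfun.scaleR_right)
        have 1: "((\<lambda>t. f' (\<gamma> t \<bullet> \<gamma> t)) has_real_derivative f'' (x \<bullet> x) * (2 * (x \<bullet> i))) (at 0)"
          using DERIV_chain2[OF f'' sq, of 0] by simp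
        have 2: "((\<lambda>t. 2 * (\<gamma> t \<bullet> i)) has_real_derivative 2) (at 0)"
          unfolding \<gamma>_def using i by (auto intro!: derivative_eq_intros simp: inner_add_left)
        show "((\<lambda>t. f' (\<gamma> t \<bullet> \<gamma> t) * (2 * (\<gamma> t \<bullet> i))) has_real_derivative
            f'' (x \<bullet> x) * (2 * (x \<bullet> i)) * (2 * (x \<bullet> i)) + f' (x \<bullet> x) * 2) (at 0)"
          using DERIV_mult[OF 1 2] by (simp add: mult_ac add.commute)
      qed
      show "g 0 \<le> g t" if "\<bar>t\<bar> < r" for t
        using min[of "\<gamma> t"] near[OF that] by (simp add: g_def r_def)
    qed
    then show ?thesis by (simp add: power2_eq_square mult_ac)
  qed
  have "4 * (x \<bullet> x) * f'' (x \<bullet> x) + 2 * DIM('a) * f' (x \<bullet> x) =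
      (\<Sum>i\<in>Basis. 4 * (x \<bullet> i)\<^sup>2 * f'' (x \<bullet> x) + 2 * f' (x \<bullet> x))"
    by (simp add: sum.distrib sum_distrib_left[symmetric] sum_distrib_right[symmetric]
        euclidean_inner[of x x] power2_eq_square)
  also have "\<dots> \<le> (\<Sum>i\<in>Basis. blinfun_apply (H x) i \<bullet> i)"
    by (rule sum_mono) (rule dir)
  also have "\<dots> = - \<sigma> * u x" using GH(3)[OF x] by simp
  finally show ?thesis .
qed

text \<open>
  Touching from below at a boundary point: moving inwards along the radius, the difference cannot
  decrease. The normal derivative of the solution is then replaced by means of the Robin condition.
\<close>

lemma robin_touching_boundary:
  assumes u: "robin_solution b \<rho> \<sigma> u" and \<rho>: "\<rho> > 0" and x: "x \<in> sphere 0 \<rho>"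
    and f: "(f has_real_derivative D) (at (\<rho>\<^sup>2))"
    and e: "e > 0" and min: "\<And>t. 0 < t \<Longrightarrow> t < e \<Longrightarrow>
      u x - f (\<rho>\<^sup>2) \<le> u ((1 - t) *\<^sub>R x) - f ((1 - t)\<^sup>2 * \<rho>\<^sup>2)"
  shows "0 \<le> b * \<rho> * u x + 2 * \<rho>\<^sup>2 * D"
proof (rule ccontr)
  assume neg: "\<not> ?thesis"
  obtain G H where w: "robin_witness b \<rho> \<sigma> u G H"
    using u unfolding robin_solution_iff_witness by blast
  note G = robin_witnessD(1)[OF w] robin_witnessD(6)[OF w]
  have Gx: "G x \<bullet> x = - b * \<rho> * u x"
    using G(2)[OF x] \<rho> by (simp add: field_simps)
  define \<gamma> where "\<gamma> = (\<lambda>t. (1 - t) *\<^sub>R x)"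
  have \<gamma>0: "\<gamma> 0 = x" by (simp add: \<gamma>_def)
  have sub: "\<gamma> ` {0..1} \<subseteq> cball 0 \<rho>"
    using x \<rho> by (auto simp: \<gamma>_def intro: mult_left_le_one_le)
  have \<gamma>': "(\<gamma> has_derivative (\<lambda>h. h *\<^sub>R (- x))) (at 0 within {0..1})"
    unfolding \<gamma>_def by (auto intro!: derivative_eq_intros)
  have "(u has_derivative (\<lambda>h. G x \<bullet> h)) (at (\<gamma> 0) within \<gamma> ` {0..1})"
    unfolding \<gamma>0 by (rule has_derivative_subset[OF G(1) sub]) (use x in simp)
  from has_derivative_in_compose[OF \<gamma>' this]
  have 1: "((\<lambda>t. u (\<gamma> t)) has_real_derivative - (G x \<bullet> x)) (at 0 within {0..1})"
    unfolding has_field_derivative_def by (rule has_derivative_eq_rhs) (auto simp: fun_eq_iff)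
  have sq: "((\<lambda>t. (1 - t)\<^sup>2 * \<rho>\<^sup>2) has_real_derivative - 2 * \<rho>\<^sup>2) (at 0 within {0..1})"
    by (auto intro!: derivative_eq_intros)
  have f': "(f has_real_derivative D) (at ((1 - 0)\<^sup>2 * \<rho>\<^sup>2))" using f by simp
  have 2: "((\<lambda>t. f ((1 - t)\<^sup>2 * \<rho>\<^sup>2)) has_real_derivative D * (- 2 * \<rho>\<^sup>2)) (at 0 within {0..1})"
    by (rule DERIV_chain2[OF f' sq])
  have "- (G x \<bullet> x) - D * (- 2 * \<rho>\<^sup>2) < 0"
    using neg Gx by (simp add: mult_ac)
  from has_real_derivative_neg_dec_right[OF DERIV_diff[OF 1 2] this]
  obtain d where d: "d > 0" "\<And>h. h > 0 \<Longrightarrow> h \<in> {0..1} \<Longrightarrow> h < d \<Longrightarrow>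
      u (\<gamma> 0) - f ((1 - 0)\<^sup>2 * \<rho>\<^sup>2) > u (\<gamma> h) - f ((1 - h)\<^sup>2 * \<rho>\<^sup>2)"
    by auto
  define h where "h = Min {d, e, 1} / 2"
  have "0 < h" "h < d" "h < e" "h < 1" using d e by (auto simp: h_def min_def)
  with d(2)[of h] min[of h] show False by (simp add: \<gamma>_def)
qed

text \<open>
  The Hopf boundary lemma for the ball. A positive solution dominates a multiple of the barrier
  $e^{-\alpha|x|^2} - e^{-\alpha\varrho^2}$ on the annulus $\varrho/2 \le |x| \le \varrho$. If it
  vanished at a boundary point, its inward derivative there would be positive, like that of
  the barrier, whereas the Robin condition makes it zero.
\<close>

lemma robin_hopf:
  fixes u :: "'a::euclidean_space \<Rightarrow> real"
  assumes u: "robin_solution b \<rho> \<sigma> u" and \<rho>: "\<rho> > 0"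
    and pos: "\<And>x. x \<in> ball 0 \<rho> \<Longrightarrow> u x > 0" and x: "x \<in> cball 0 \<rho>"
  shows "u x > 0"
proof (cases "x \<in> ball 0 \<rho>")
  case False
  with x have xs: "x \<in> sphere 0 \<rho>" by auto
  have cont: "continuous_on (cball 0 \<rho>) u" by (rule robin_solution_continuous[OF u])
  have nonneg: "u y \<ge> 0" if "y \<in> cball 0 \<rho>" for y
  proof (rule continuous_ge_on_closure[of "ball 0 \<rho>" u])
    show "continuous_on (closure (ball 0 \<rho>)) u" "y \<in> closure (ball 0 \<rho>)"
      using cont that \<rho> by auto
    show "\<And>z. z \<in> ball 0 \<rho> \<Longrightarrow> 0 \<le> u z" using pos by (simp add: less_imp_le)
  qed
  \<comment> \<open>Chosen so that the Laplacian of the barrier exceeds the absolute value of the eigenvalue times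
    the exponential on the annulus.\<close>
  define \<alpha> where "\<alpha> = (2 * DIM('a) + \<bar>\<sigma>\<bar> + 1) / \<rho>\<^sup>2 + 1"
  have \<alpha>: "\<alpha> \<ge> 1" using \<rho> by (simp add: \<alpha>_def)
  have \<alpha>2: "\<rho>\<^sup>2 * \<alpha>\<^sup>2 - 2 * DIM('a) * \<alpha> > \<bar>\<sigma>\<bar>"
  proof -
    have "\<rho>\<^sup>2 * \<alpha>\<^sup>2 - 2 * DIM('a) * \<alpha> = \<alpha> * (\<rho>\<^sup>2 * \<alpha> - 2 * DIM('a))"
      by (simp add: power2_eq_square algebra_simps)
    also have "\<rho>\<^sup>2 * \<alpha> - 2 * DIM('a) = \<bar>\<sigma>\<bar> + 1 + \<rho>\<^sup>2"
      using \<rho> by (simp add: \<alpha>_def field_simps)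
    also have "\<alpha> * (\<bar>\<sigma>\<bar> + 1 + \<rho>\<^sup>2) \<ge> 1 * (\<bar>\<sigma>\<bar> + 1 + \<rho>\<^sup>2)"
      using \<alpha> by (intro mult_right_mono) auto
    finally show ?thesis using \<rho> by (smt (verit) zero_le_power2)
  qed
  define z where "z = (\<lambda>s. exp (- \<alpha> * s) - exp (- \<alpha> * \<rho>\<^sup>2))"
  have "\<exists>x0\<in>sphere 0 (\<rho> / 2). \<forall>y\<in>sphere 0 (\<rho> / 2). u x0 \<le> u y"
  proof (rule continuous_attains_inf)
    show "sphere (0 :: 'a) (\<rho> / 2) \<noteq> {}" using \<rho> by simp
    show "continuous_on (sphere 0 (\<rho> / 2)) u"
      using \<rho> by (intro continuous_on_subset[OF cont]) auto
  qed simp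
  then obtain x0 where x0: "x0 \<in> sphere 0 (\<rho> / 2)" "\<And>y. y \<in> sphere 0 (\<rho> / 2) \<Longrightarrow> u x0 \<le> u y"
    by blast
  define m where "m = u x0"
  have m: "m > 0" unfolding m_def using x0(1) \<rho> by (intro pos) auto
  define w where "w = (\<lambda>y. u y - m * z (y \<bullet> y))"
  define A where "A = cball (0 :: 'a) \<rho> - ball 0 (\<rho> / 2)"
  have A: "y \<in> A \<longleftrightarrow> \<rho> / 2 \<le> norm y \<and> norm y \<le> \<rho>" for y by (auto simp: A_def)
  have w_nonneg: "w y \<ge> 0" if "y \<in> A" for y
  proof -
    have "\<exists>y0\<in>A. \<forall>y\<in>A. w y0 \<le> w y"
    proof (rule continuous_attains_inf)
      show "compact A" unfolding A_def by (intro compact_diff) auto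
      show "A \<noteq> {}" using that by auto
      show "continuous_on A w" unfolding w_def z_def
        by (intro continuous_intros continuous_on_subset[OF cont]) (auto simp: A_def)
    qed
    then obtain y0 where y0: "y0 \<in> A" "\<And>y. y \<in> A \<Longrightarrow> w y0 \<le> w y" by blast
    \<comment> \<open>A negative minimum would be interior and contradict the choice of the exponent.\<close>
    have "w y0 \<ge> 0"
    proof (rule ccontr)
      assume neg: "\<not> ?thesis"
      have s: "y0 \<bullet> y0 = (norm y0)\<^sup>2" by (simp add: power2_norm_eq_inner)
      have y0c: "y0 \<in> cball 0 \<rho>" using y0(1) by (simp add: A_def)
      have "norm y0 \<noteq> \<rho>"
        using neg nonneg[OF y0c] by (auto simp: w_def s z_def)
      moreover have "norm y0 \<noteq> \<rho> / 2"
      proof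
        assume eq: "norm y0 = \<rho> / 2"
        have "m * z (y0 \<bullet> y0) \<le> m * 1"
        proof (rule mult_left_mono)
          have "exp (- \<alpha> * (y0 \<bullet> y0)) \<le> 1" using \<alpha> by simp
          then show "z (y0 \<bullet> y0) \<le> 1" unfolding z_def by (smt (verit) exp_gt_zero)
        qed (use m in simp)
        moreover have "u y0 \<ge> m" using x0(2)[of y0] eq by (simp add: m_def)
        ultimately show False using neg by (simp add: w_def)
      qed
      ultimately have y0i: "\<rho> / 2 < norm y0" "norm y0 < \<rho>" using y0(1) A by force+
      define e where "e = min (norm y0 - \<rho> / 2) (\<rho> - norm y0)"
      have e: "e > 0" using y0i by (simp add: e_def)
      have "4 * (y0 \<bullet> y0) * (m * \<alpha>\<^sup>2 * exp (- \<alpha> * (y0 \<bullet> y0))) +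
          2 * DIM('a) * (- m * \<alpha> * exp (- \<alpha> * (y0 \<bullet> y0))) \<le> - \<sigma> * u y0"
      proof (rule robin_touching_interior[OF u, where e = e and f = "\<lambda>s. m * z s" and
            f' = "\<lambda>s. - m * \<alpha> * exp (- \<alpha> * s)" and f'' = "\<lambda>s. m * \<alpha>\<^sup>2 * exp (- \<alpha> * s)"])
        show "((\<lambda>s. m * z s) has_real_derivative - m * \<alpha> * exp (- \<alpha> * s)) (at s)" for s
          unfolding z_def by (auto intro!: derivative_eq_intros)
        show "((\<lambda>s. - m * \<alpha> * exp (- \<alpha> * s)) has_real_derivative m * \<alpha>\<^sup>2 * exp (- \<alpha> * s)) (at s)" for s
          by (auto intro!: derivative_eq_intros simp: power2_eq_square)
        show "u y0 - m * z (y0 \<bullet> y0) \<le> u y - m * z (y \<bullet> y)" if "dist y0 y < e" for y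
        proof -
          have "\<bar>norm y0 - norm y\<bar> < e"
            using that norm_triangle_ineq3[of y0 y] by (simp add: dist_norm)
          then have "y \<in> A" unfolding A by (auto simp: e_def)
          then show ?thesis using y0(2) by (simp add: w_def)
        qed
      qed (use y0i e in auto)
      also have "\<dots> \<le> \<bar>\<sigma>\<bar> * u y0"
        using nonneg[OF y0c] by (intro mult_right_mono) auto
      also have "\<dots> \<le> \<bar>\<sigma>\<bar> * (m * exp (- \<alpha> * (y0 \<bullet> y0)))"
      proof (rule mult_left_mono)
        have "u y0 \<le> m * z (y0 \<bullet> y0)" using neg by (simp add: w_def)
        also have "\<dots> \<le> m * exp (- \<alpha> * (y0 \<bullet> y0))"
          using m by (intro mult_left_mono) (auto simp: z_def)
        finally show "u y0 \<le> m * exp (- \<alpha> * (y0 \<bullet> y0))" .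
      qed simp
      finally have "(4 * (y0 \<bullet> y0) * \<alpha>\<^sup>2 - 2 * DIM('a) * \<alpha>) * (m * exp (- \<alpha> * (y0 \<bullet> y0))) \<le>
          \<bar>\<sigma>\<bar> * (m * exp (- \<alpha> * (y0 \<bullet> y0)))"
        by (simp add: algebra_simps)
      then have "4 * (y0 \<bullet> y0) * \<alpha>\<^sup>2 - 2 * DIM('a) * \<alpha> \<le> \<bar>\<sigma>\<bar>"
        using m by (subst (asm) mult_le_cancel_right_pos) auto
      moreover have "\<rho>\<^sup>2 * \<alpha>\<^sup>2 \<le> 4 * (y0 \<bullet> y0) * \<alpha>\<^sup>2"
      proof (rule mult_right_mono)
        have "(\<rho> / 2)\<^sup>2 \<le> (norm y0)\<^sup>2" using y0i \<rho> by (intro power_mono) auto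
        then show "\<rho>\<^sup>2 \<le> 4 * (y0 \<bullet> y0)" by (simp add: s power_divide)
      qed simp
      ultimately show False using \<alpha>2 by linarith
    qed
    with y0(2)[OF that] show ?thesis by linarith
  qed
  show ?thesis
  proof (rule ccontr)
    assume "\<not> u x > 0"
    with nonneg[OF x] have ux: "u x = 0" by simp
    have nx: "norm x = \<rho>" using xs by simp
    have "0 \<le> b * \<rho> * u x + 2 * \<rho>\<^sup>2 * (- m * \<alpha> * exp (- \<alpha> * \<rho>\<^sup>2))"
    proof (rule robin_touching_boundary[OF u \<rho> xs, where e = "1 / 2" and f = "\<lambda>s. m * z s"])
      show "((\<lambda>s. m * z s) has_real_derivative - m * \<alpha> * exp (- \<alpha> * \<rho>\<^sup>2)) (at (\<rho>\<^sup>2))"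
        unfolding z_def by (auto intro!: derivative_eq_intros)
      show "u x - m * z (\<rho>\<^sup>2) \<le> u ((1 - t) *\<^sub>R x) - m * z ((1 - t)\<^sup>2 * \<rho>\<^sup>2)"
        if t: "0 < t" "t < 1 / 2" for t
      proof -
        have "norm ((1 - t) *\<^sub>R x) = (1 - t) * \<rho>"
          using t nx by (simp only: norm_scaleR)
        moreover have "1 / 2 * \<rho> \<le> (1 - t) * \<rho>" "(1 - t) * \<rho> \<le> 1 * \<rho>"
          using t \<rho> by (intro mult_right_mono; simp)+
        ultimately have "(1 - t) *\<^sub>R x \<in> A" unfolding A by simp
        moreover have "((1 - t) *\<^sub>R x) \<bullet> ((1 - t) *\<^sub>R x) = (1 - t)\<^sup>2 * \<rho>\<^sup>2"
          using nx by (simp add: power2_norm_eq_inner[symmetric] power_mult_distrib)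
        ultimately show ?thesis
          using w_nonneg[of "(1 - t) *\<^sub>R x"] ux by (simp add: w_def z_def)
      qed
    qed simp
    moreover have "m * \<alpha> * exp (- \<alpha> * \<rho>\<^sup>2) * \<rho>\<^sup>2 > 0"
      using m \<alpha> \<rho> by (intro mult_pos_pos) auto
    ultimately show False using ux by (simp add: algebra_simps)
  qed
qed (use pos in auto)

section \<open>The principal eigenvalue of a ball\<close>

lemma robin_solution_radial:
  fixes \<rho> b \<tau> :: real
  defines "a \<equiv> real DIM('a::euclidean_space) / 2"
  assumes a: "1 \<le> a" and \<rho>: "\<rho> > 0"
    and bc: "2 * (\<tau> * \<rho>\<^sup>2) * radial' a (\<tau> * \<rho>\<^sup>2) + b * \<rho> * radial a (\<tau> * \<rho>\<^sup>2) = 0"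
  shows "robin_solution b \<rho> \<tau> (\<lambda>x :: 'a. radial a (\<tau> * (x \<bullet> x)))"
proof -
  define G where "G = (\<lambda>x :: 'a. (2 * \<tau> * radial' a (\<tau> * (x \<bullet> x))) *\<^sub>R x)"
  define H where "H = (\<lambda>x :: 'a. (2 * \<tau> * radial' a (\<tau> * (x \<bullet> x))) *\<^sub>R id_blinfun +
    (4 * \<tau>\<^sup>2 * radial'' a (\<tau> * (x \<bullet> x))) *\<^sub>R (blinfun_scaleR_left x o\<^sub>L blinfun_inner_right x))"
  have sq: "((\<lambda>x :: 'a. \<tau> * (x \<bullet> x)) has_derivative (\<lambda>h. 2 * \<tau> * (x \<bullet> h))) (at x within S)" for x S
    by (auto intro!: derivative_eq_intros simp: fun_eq_iff inner_commute)
  have H: "blinfun_apply (H x) h = (2 * \<tau> * radial' a (\<tau> * (x \<bullet> x))) *\<^sub>R h +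
      (4 * \<tau>\<^sup>2 * radial'' a (\<tau> * (x \<bullet> x)) * (x \<bullet> h)) *\<^sub>R x" for x h
    by (simp add: H_def blinfun.add_left blinfun.scaleR_left)
  have "robin_witness b \<rho> \<tau> (\<lambda>x :: 'a. radial a (\<tau> * (x \<bullet> x))) G H"
    unfolding robin_witness_def
  proof (intro conjI ballI)
    fix x :: 'a
    have "((\<lambda>x :: 'a. radial a (\<tau> * (x \<bullet> x))) has_derivative
        (\<lambda>h. (2 * \<tau> * (x \<bullet> h)) * radial' a (\<tau> * (x \<bullet> x)))) (at x within cball 0 \<rho>)"
      using has_derivative_compose[OF sq DERIV_radial[OF a, unfolded has_field_derivative_def]]
      by (simp add: mult_ac)
    then show "((\<lambda>x :: 'a. radial a (\<tau> * (x \<bullet> x))) has_derivative (\<lambda>h. G x \<bullet> h)) (at x within cball 0 \<rho>)"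
      by (simp add: G_def mult_ac)
  next
    fix x :: 'a
    have 1: "((\<lambda>x :: 'a. 2 * \<tau> * radial' a (\<tau> * (x \<bullet> x))) has_derivative
        (\<lambda>h. 2 * \<tau> * (radial'' a (\<tau> * (x \<bullet> x)) * (2 * \<tau> * (x \<bullet> h))))) (at x)"
      by (intro has_derivative_mult_right
          has_derivative_compose[OF sq DERIV_radial'[OF a, unfolded has_field_derivative_def]])
    show "(G has_derivative blinfun_apply (H x)) (at x)"
      unfolding G_def
      by (rule has_derivative_eq_rhs[OF has_derivative_scaleR[OF 1 has_derivative_ident]])
         (simp add: fun_eq_iff H power2_eq_square mult_ac)
  next
    fix x :: 'a
    define A where "A = 2 * \<tau> * radial' a (\<tau> * (x \<bullet> x))"
    define B where "B = 4 * \<tau>\<^sup>2 * radial'' a (\<tau> * (x \<bullet> x))"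
    have "(\<Sum>i\<in>Basis. blinfun_apply (H x) i \<bullet> i) = (\<Sum>i\<in>Basis. A + B * ((x \<bullet> i) * (x \<bullet> i)))"
      unfolding H A_def[symmetric] B_def[symmetric] by (simp add: inner_add_left mult.assoc)
    also have "\<dots> = A * DIM('a) + B * (x \<bullet> x)"
      by (simp add: sum.distrib sum_distrib_left[symmetric] euclidean_inner[of x x, symmetric])
    also have "\<dots> = 4 * \<tau> * (\<tau> * (x \<bullet> x) * radial'' a (\<tau> * (x \<bullet> x)) + a * radial' a (\<tau> * (x \<bullet> x)))"
      by (simp add: A_def B_def a_def power2_eq_square algebra_simps)
    also have "\<dots> = - \<tau> * radial a (\<tau> * (x \<bullet> x))"
      using radial_ode[OF a, of "\<tau> * (x \<bullet> x)"] by simp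
    finally show "- (\<Sum>i\<in>Basis. blinfun_apply (H x) i \<bullet> i) = \<tau> * radial a (\<tau> * (x \<bullet> x))" by simp
  next
    fix x :: 'a assume "x \<in> sphere 0 \<rho>"
    then have x: "x \<bullet> x = \<rho>\<^sup>2" by (simp add: power2_norm_eq_inner[symmetric])
    have "G x \<bullet> (x /\<^sub>R \<rho>) + b * radial a (\<tau> * (x \<bullet> x)) =
        (2 * (\<tau> * \<rho>\<^sup>2) * radial' a (\<tau> * \<rho>\<^sup>2) + b * \<rho> * radial a (\<tau> * \<rho>\<^sup>2)) / \<rho>"
      using \<rho> by (simp add: G_def x field_simps)
    then show "G x \<bullet> (x /\<^sub>R \<rho>) + b * radial a (\<tau> * (x \<bullet> x)) = 0"
      unfolding bc by simp
  next
    show "continuous_on (cball 0 \<rho>) G" unfolding G_def using a by (intro continuous_intros)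
    show "continuous_on (ball 0 \<rho>) H" unfolding H_def using a
      by (intro continuous_intros bounded_bilinear.continuous_on[OF bounded_bilinear_blinfun_compose]
          bounded_linear.continuous_on[OF bounded_linear_blinfun_scaleR_left]
          bounded_linear.continuous_on[OF bounded_linear_blinfun_inner_right])
  qed
  then show ?thesis unfolding robin_solution_iff_witness by blast
qed

context
  fixes \<rho> b \<sigma> \<tau> a :: real and u :: "'a::euclidean_space \<Rightarrow> real"
  assumes a_def: "a = real DIM('a) / 2" and a: "1 \<le> a"
    and u: "robin_solution b \<rho> \<sigma> u" and \<rho>: "\<rho> > 0"
    and pos: "\<And>x. x \<in> ball 0 \<rho> \<Longrightarrow> u x > 0"
    and dom: "\<tau> * \<rho>\<^sup>2 \<in> radial_dom a"
begin

lemma radial_pos_on_cball: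
  assumes x: "x \<in> cball (0 :: 'a) \<rho>"
  shows "radial a (\<tau> * (x \<bullet> x)) > 0"
proof (rule radial_pos[OF a])
  have "x \<bullet> x \<le> \<rho>\<^sup>2"
    using x \<rho> by (simp add: power2_norm_eq_inner[symmetric] power_mono)
  then show "\<tau> * (x \<bullet> x) \<in> radial_dom a"
    by (intro radial_dom_mult[OF a dom]) simp_all
qed

text \<open>
  A radial solution with parameter $\tau$ satisfies the same differential equation with $\tau$ in
  place of $\sigma$ and a Robin condition with constant
  \<open>robin_quot a (\<tau> * \<rho>\<^sup>2) / \<rho>\<close> in place of \<open>b\<close>. At an interior point of contact the
  two Laplacians are compared, at a boundary point the two normal derivatives. The sign of
  \<open>k\<close> is free, so that contact from above is covered by passing to negatives.
\<close>

lemma touching_radial: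
  fixes k :: real and v :: "'a \<Rightarrow> real"
  assumes v: "robin_solution b \<rho> \<sigma> v" and x: "x \<in> cball 0 \<rho>"
    and vx: "v x = k * radial a (\<tau> * (x \<bullet> x))"
    and ge: "\<And>y. y \<in> cball 0 \<rho> \<Longrightarrow> k * radial a (\<tau> * (y \<bullet> y)) \<le> v y"
  shows "\<sigma> * v x \<le> \<tau> * v x \<or> robin_quot a (\<tau> * \<rho>\<^sup>2) * v x \<le> b * \<rho> * v x"
proof (cases "x \<in> ball 0 \<rho>")
  case True
  then obtain e where e: "e > 0" "ball x e \<subseteq> ball 0 \<rho>"
    using open_contains_ball[THEN iffD1, OF open_ball] by blast
  let ?f = "\<lambda>s. k * radial a (\<tau> * s)" and ?f' = "\<lambda>s. k * \<tau> * radial' a (\<tau> * s)"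
    and ?f'' = "\<lambda>s. k * \<tau>\<^sup>2 * radial'' a (\<tau> * s)"
  have "4 * (x \<bullet> x) * ?f'' (x \<bullet> x) + 2 * DIM('a) * ?f' (x \<bullet> x) \<le> - \<sigma> * v x"
  proof (rule robin_touching_interior[OF v True, where f = ?f and f' = ?f' and f'' = ?f''])
    show "(?f has_real_derivative ?f' s) (at s)" for s
      using a by (auto intro!: derivative_eq_intros)
    show "(?f' has_real_derivative ?f'' s) (at s)" for s
      using a by (auto intro!: derivative_eq_intros simp: power2_eq_square)
    show "e > 0" by fact
    show "v x - ?f (x \<bullet> x) \<le> v y - ?f (y \<bullet> y)" if "dist x y < e" for y
      using ge[of y] vx that e(2) by (auto simp: subset_iff)
  qed
  also have "4 * (x \<bullet> x) * ?f'' (x \<bullet> x) + 2 * DIM('a) * ?f' (x \<bullet> x) =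
      4 * k * \<tau> * (\<tau> * (x \<bullet> x) * radial'' a (\<tau> * (x \<bullet> x)) + a * radial' a (\<tau> * (x \<bullet> x)))"
    by (simp add: a_def power2_eq_square algebra_simps)
  also have "\<dots> = - \<tau> * v x"
    using radial_ode[OF a, of "\<tau> * (x \<bullet> x)"] by (simp add: vx)
  finally show ?thesis by simp
next
  case False
  with x have xs: "x \<in> sphere 0 \<rho>" by auto
  then have xx: "x \<bullet> x = \<rho>\<^sup>2" by (simp add: power2_norm_eq_inner[symmetric])
  have "0 \<le> b * \<rho> * v x + 2 * \<rho>\<^sup>2 * (k * \<tau> * radial' a (\<tau> * \<rho>\<^sup>2))"
  proof (rule robin_touching_boundary[OF v \<rho> xs, where e = 1 and f = "\<lambda>s. k * radial a (\<tau> * s)"])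
    show "((\<lambda>s. k * radial a (\<tau> * s)) has_real_derivative k * \<tau> * radial' a (\<tau> * \<rho>\<^sup>2)) (at (\<rho>\<^sup>2))"
      using a by (auto intro!: derivative_eq_intros)
    show "v x - k * radial a (\<tau> * \<rho>\<^sup>2) \<le>
        v ((1 - t) *\<^sub>R x) - k * radial a (\<tau> * ((1 - t)\<^sup>2 * \<rho>\<^sup>2))" if t: "0 < t" "t < 1" for t
    proof -
      have nx: "norm x = \<rho>" using xs by simp
      have "norm ((1 - t) *\<^sub>R x) = (1 - t) * \<rho>"
        using t nx by (simp only: norm_scaleR)
      also have "\<dots> \<le> 1 * \<rho>" using t \<rho> by (intro mult_right_mono) auto
      finally have "(1 - t) *\<^sub>R x \<in> cball 0 \<rho>" by simp
      from ge[OF this] have "k * radial a (\<tau> * ((1 - t)\<^sup>2 * \<rho>\<^sup>2)) \<le> v ((1 - t) *\<^sub>R x)"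
        by (simp add: xx power2_eq_square mult.assoc)
      then show ?thesis using vx by (simp add: xx)
    qed
  qed simp
  moreover have "robin_quot a (\<tau> * \<rho>\<^sup>2) * v x = - 2 * \<rho>\<^sup>2 * (k * \<tau> * radial' a (\<tau> * \<rho>\<^sup>2))"
    using radial_pos[OF a dom] by (simp add: vx xx robin_quot_def field_simps)
  ultimately show ?thesis by simp
qed

lemma quotient_continuous:
  "continuous_on (cball 0 \<rho>) (\<lambda>x. u x / radial a (\<tau> * (x \<bullet> x)))"
  using radial_pos_on_cball a
  by (intro continuous_intros robin_solution_continuous[OF u]) force+

text \<open>
  The minimum of the quotient of \<open>u\<close> by the radial solution is a point of contact from below. The
  Hopf lemma excludes that this minimum is zero.
\<close>

lemma comparison_from_below: "\<sigma> \<le> \<tau> \<or> robin_quot a (\<tau> * \<rho>\<^sup>2) \<le> b * \<rho>"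
proof -
  have "\<exists>x\<in>cball 0 \<rho>. \<forall>y\<in>cball 0 \<rho>. u x / radial a (\<tau> * (x \<bullet> x)) \<le> u y / radial a (\<tau> * (y \<bullet> y))"
    using \<rho> by (intro continuous_attains_inf quotient_continuous) auto
  then obtain x where x: "x \<in> cball 0 \<rho>"
    and min: "\<And>y. y \<in> cball 0 \<rho> \<Longrightarrow> u x / radial a (\<tau> * (x \<bullet> x)) \<le> u y / radial a (\<tau> * (y \<bullet> y))"
    by blast
  define k where "k = u x / radial a (\<tau> * (x \<bullet> x))"
  have ux: "u x > 0" using robin_hopf[OF u \<rho> pos x] .
  have "\<sigma> * u x \<le> \<tau> * u x \<or> robin_quot a (\<tau> * \<rho>\<^sup>2) * u x \<le> b * \<rho> * u x"
  proof (rule touching_radial[OF u x])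
    show "u x = k * radial a (\<tau> * (x \<bullet> x))"
      using radial_pos_on_cball[OF x] by (simp add: k_def)
    show "k * radial a (\<tau> * (y \<bullet> y)) \<le> u y" if "y \<in> cball 0 \<rho>" for y
      using min[OF that] radial_pos_on_cball[OF that] unfolding k_def[symmetric]
      by (simp add: pos_le_divide_eq)
  qed
  then show ?thesis using ux by simp
qed

lemma comparison_from_above: "\<tau> \<le> \<sigma> \<or> b * \<rho> \<le> robin_quot a (\<tau> * \<rho>\<^sup>2)"
proof -
  have "\<exists>x\<in>cball 0 \<rho>. \<forall>y\<in>cball 0 \<rho>. u y / radial a (\<tau> * (y \<bullet> y)) \<le> u x / radial a (\<tau> * (x \<bullet> x))"
    using \<rho> by (intro continuous_attains_sup quotient_continuous) auto
  then obtain x where x: "x \<in> cball 0 \<rho>"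
    and max: "\<And>y. y \<in> cball 0 \<rho> \<Longrightarrow> u y / radial a (\<tau> * (y \<bullet> y)) \<le> u x / radial a (\<tau> * (x \<bullet> x))"
    by blast
  define k where "k = u x / radial a (\<tau> * (x \<bullet> x))"
  have ux: "u x > 0" using robin_hopf[OF u \<rho> pos x] .
  have "\<sigma> * (- u x) \<le> \<tau> * (- u x) \<or> robin_quot a (\<tau> * \<rho>\<^sup>2) * (- u x) \<le> b * \<rho> * (- u x)"
  proof (rule touching_radial[OF robin_solution_uminus[OF u] x])
    show "- u x = - k * radial a (\<tau> * (x \<bullet> x))"
      using radial_pos_on_cball[OF x] by (simp add: k_def)
    show "- k * radial a (\<tau> * (y \<bullet> y)) \<le> - u y" if "y \<in> cball 0 \<rho>" for y
      using max[OF that] radial_pos_on_cball[OF that] unfolding k_def[symmetric]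
      by (simp add: pos_divide_le_eq)
  qed
  then show ?thesis using ux by simp
qed

end

text \<open>
  The radial solution with the right boundary value is positive, which gives existence. If there
  were a positive solution with another eigenvalue $\sigma$, a radial solution with parameter
  strictly between would have to satisfy, by comparison, a boundary inequality opposite to the
  one that follows from strict monotonicity of \<open>robin_quot\<close>.
\<close>

theorem principal_eigenvalue_ball:
  fixes \<rho> b :: real
  defines "a \<equiv> real DIM('a::euclidean_space) / 2"
  assumes dim: "2 \<le> DIM('a)" and \<rho>: "\<rho> > 0"
  shows "principal_eigenvalue TYPE('a) b \<rho> = robin_inv a (b * \<rho>) / \<rho>\<^sup>2"
proof -
  have a: "1 \<le> a" using dim by (simp add: a_def)
  define z where "z = robin_inv a (b * \<rho>)"
  define s where "s = z / \<rho>\<^sup>2"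
  have z: "z \<in> radial_dom a" "robin_quot a z = b * \<rho>"
    using robin_inv_in_dom[OF a] robin_quot_inv[OF a] by (auto simp: z_def)
  have sz: "s * \<rho>\<^sup>2 = z" using \<rho> by (simp add: s_def)
  have "(THE \<sigma>. \<exists>u :: 'a \<Rightarrow> real. robin_solution b \<rho> \<sigma> u \<and> (\<forall>x\<in>ball 0 \<rho>. u x > 0)) = s"
  proof (rule the_equality)
    let ?u = "\<lambda>x :: 'a. radial a (s * (x \<bullet> x))"
    have "robin_solution b \<rho> s ?u"
      unfolding a_def
    proof (rule robin_solution_radial[OF _ \<rho>])
      show "2 * (s * \<rho>\<^sup>2) * radial' (real DIM('a) / 2) (s * \<rho>\<^sup>2) +
          b * \<rho> * radial (real DIM('a) / 2) (s * \<rho>\<^sup>2) = 0"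
        using z robin_quot_eq_iff[OF a z(1)] unfolding sz a_def by blast
    qed (use a in \<open>simp add: a_def\<close>)
    moreover have "?u x > 0" if x: "x \<in> ball 0 \<rho>" for x
    proof (rule radial_pos[OF a])
      have dom: "s * \<rho>\<^sup>2 \<in> radial_dom a" unfolding sz by (rule z(1))
      have "x \<bullet> x \<le> \<rho>\<^sup>2"
        using x \<rho> by (simp add: power2_norm_eq_inner[symmetric] power_mono)
      then show "s * (x \<bullet> x) \<in> radial_dom a"
        by (rule radial_dom_mult[OF a dom inner_ge_zero])
    qed
    ultimately show "\<exists>u :: 'a \<Rightarrow> real. robin_solution b \<rho> s u \<and> (\<forall>x\<in>ball 0 \<rho>. u x > 0)" by blast
  next
    fix \<sigma> assume "\<exists>u :: 'a \<Rightarrow> real. robin_solution b \<rho> \<sigma> u \<and> (\<forall>x\<in>ball 0 \<rho>. u x > 0)"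
    then obtain u :: "'a \<Rightarrow> real" where u: "robin_solution b \<rho> \<sigma> u" "\<And>x. x \<in> ball 0 \<rho> \<Longrightarrow> u x > 0"
      by blast
    note cmp = comparison_from_below[OF a_def[THEN meta_eq_to_obj_eq] a u(1) \<rho> u(2)]
      comparison_from_above[OF a_def[THEN meta_eq_to_obj_eq] a u(1) \<rho> u(2)]
    show "\<sigma> = s"
    proof (cases \<sigma> s rule: linorder_cases)
      case less
      then obtain \<tau> where \<tau>: "\<sigma> < \<tau>" "\<tau> < s" using dense by blast
      have lt: "\<tau> * \<rho>\<^sup>2 < z" unfolding sz[symmetric] using \<tau> \<rho> by (intro mult_strict_right_mono) auto
      have dom: "\<tau> * \<rho>\<^sup>2 \<in> radial_dom a" using radial_dom_down[OF a z(1)] lt by simp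
      have "robin_quot a (\<tau> * \<rho>\<^sup>2) < b * \<rho>"
        using robin_quot_strict_mono[OF a z(1) lt] z(2) by simp
      with cmp(2)[OF _ dom] \<tau> show ?thesis by force
    next
      case greater
      obtain e where e: "e > 0" "ball z e \<subseteq> radial_dom a"
        using open_contains_ball[THEN iffD1, OF open_radial_dom[OF a]] z(1) by blast
      \<comment> \<open>A point beyond \<open>z\<close> that is still in the open domain and still below \<open>\<sigma> * \<rho>\<^sup>2\<close>.\<close>
      define w where "w = min (z + e / 2) ((z + \<sigma> * \<rho>\<^sup>2) / 2)"
      define \<tau> where "\<tau> = w / \<rho>\<^sup>2"
      have \<tau>w: "\<tau> * \<rho>\<^sup>2 = w" using \<rho> by (simp add: \<tau>_def)
      have "z < \<sigma> * \<rho>\<^sup>2" unfolding sz[symmetric] using greater \<rho> by (intro mult_strict_right_mono) auto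
      then have w: "z < w" "w < z + e" "w < \<sigma> * \<rho>\<^sup>2"
        using e(1) unfolding w_def by (simp_all add: min_less_iff_disj)
      have dom: "\<tau> * \<rho>\<^sup>2 \<in> radial_dom a"
        using e(2) w unfolding \<tau>w by (auto simp: dist_real_def subset_iff)
      have "robin_quot a (\<tau> * \<rho>\<^sup>2) > b * \<rho>"
        using robin_quot_strict_mono[OF a dom[unfolded \<tau>w] w(1)] z(2) \<tau>w by simp
      moreover have "\<tau> < \<sigma>" using w(3) \<rho> by (simp add: \<tau>_def divide_less_eq)
      ultimately show ?thesis using cmp(1)[OF _ dom] by force
    qed
  qed
  then show ?thesis by (simp add: principal_eigenvalue_def s_def z_def)
qed

section \<open>The area of the unit sphere\<close>

text \<open>
  The distribution of $|y|^2$ under Lebesgue measure on $\mathbb{R}^n$. Using the square of the norm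
  turns the area integral of the sphere into a Beta integral without a change of variables.
\<close>

definition sq_dist :: "real \<Rightarrow> real measure" where
  "sq_dist n = density lborel (\<lambda>s. ennreal (unit_ball_vol n * (n / 2) * s powr (n / 2 - 1)) * indicator {0..} s)"

lemma emeasure_sq_dist_atMost:
  assumes n: "n > 0" 
  shows "emeasure (sq_dist n) {..s} = ennreal (unit_ball_vol n * (max 0 s) powr (n / 2))"
proof -
  have "((\<lambda>t. t powr (n / 2 - 1)) has_integral (max 0 s powr (n / 2 - 1 + 1) / (n / 2 - 1 + 1))) {0..max 0 s}"
    using n by (intro has_integral_powr_from_0) auto
  then have "((\<lambda>t. unit_ball_vol n * (n / 2) * t powr (n / 2 - 1)) has_integral
      unit_ball_vol n * (n / 2) * (max 0 s powr (n / 2) / (n / 2))) {0..max 0 s}"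
    by (intro has_integral_mult_right) simp
  also have "unit_ball_vol n * (n / 2) * (max 0 s powr (n / 2) / (n / 2)) = unit_ball_vol n * max 0 s powr (n / 2)"
    using n by simp
  finally have I: "((\<lambda>t. unit_ball_vol n * (n / 2) * t powr (n / 2 - 1)) has_integral
      unit_ball_vol n * max 0 s powr (n / 2)) {0..max 0 s}" .
  have "emeasure (sq_dist n) {..s} =
      (\<integral>\<^sup>+t. ennreal (unit_ball_vol n * (n / 2) * t powr (n / 2 - 1)) * indicator {0..} t * indicator {..s} t \<partial>lborel)"
    unfolding sq_dist_def by (subst emeasure_density) auto
  also have "\<dots> = (\<integral>\<^sup>+t. ennreal (indicator {0..max 0 s} t *\<^sub>R (unit_ball_vol n * (n / 2) * t powr (n / 2 - 1))) \<partial>lborel)"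
    by (intro nn_integral_cong) (auto simp: indicator_def max_def)
  also have "\<dots> = ennreal (unit_ball_vol n * max 0 s powr (n / 2))"
    using nn_integral_has_integral_lebesgue[OF _ I] n by (simp add: mult.commute)
  finally show ?thesis .
qed

text \<open>
  The sublevel sets of $|y|^2$ are balls, whose volume is known, and half-lines generate the
  Borel sets.
\<close>

lemma distr_sum_squares:
  assumes A: "finite A" "A \<noteq> {}"
  shows "distr (\<Pi>\<^sub>M i\<in>A. lborel) borel (\<lambda>f. \<Sum>i\<in>A. (f i)\<^sup>2) = sq_dist (card A)"
proof -
  let ?P = "\<Pi>\<^sub>M i\<in>A. lborel :: real measure"
  let ?v = "unit_ball_vol (card A)"
  let ?M = "distr ?P borel (\<lambda>f. \<Sum>i\<in>A. (f i)\<^sup>2)"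
  have n: "card A > 0" using A by (simp add: card_gt_0_iff)
  have meas: "(\<lambda>f. \<Sum>i\<in>A. (f i)\<^sup>2) \<in> borel_measurable ?P" by measurable
  have pos: "emeasure ?M {..s} = ennreal (?v * sqrt s ^ card A)" if s: "s > 0" for s
  proof -
    have "emeasure ?M {..s} = emeasure ?P ({f. sqrt (\<Sum>i\<in>A. (f i)\<^sup>2) \<le> sqrt s} \<inter> space ?P)"
      by (subst emeasure_distr[OF meas]) (auto intro!: arg_cong[where f = "emeasure ?P"])
    also have "\<dots> = ennreal (?v * sqrt s ^ card A)"
      using s by (intro emeasure_cball_aux A) auto
    finally show ?thesis .
  qed
  \<comment> \<open>The volume formula needs a positive radius; radius zero follows by shrinking balls.\<close>
  have "emeasure ?M {..0} \<le> 0"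
  proof (rule ennreal_le_epsilon)
    fix e :: real assume e: "e > 0"
    define r where "r = min 1 (e / ?v)"
    have v: "?v > 0" by (rule unit_ball_vol_pos) simp
    have r: "0 < r" "r \<le> 1" using e by (auto simp: r_def)
    have "?v * r ^ card A \<le> ?v * r"
      using power_decreasing[of 1 "card A" r] n r by (intro mult_left_mono) auto
    also have "?v * r \<le> ?v * (e / ?v)" by (intro mult_left_mono) (auto simp: r_def)
    also have "\<dots> = e" using v by (simp del: unit_ball_vol_pos)
    finally have le: "?v * r ^ card A \<le> e" .
    have "emeasure ?M {..0} \<le> emeasure ?M {..r\<^sup>2}"
      using r by (intro emeasure_mono) auto
    also have "\<dots> = ennreal (?v * r ^ card A)"
      using pos[of "r\<^sup>2"] r by simp
    also have "\<dots> \<le> ennreal e" using le by (rule ennreal_leI)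
    finally show "emeasure ?M {..0} \<le> 0 + ennreal e" by simp
  qed
  then have neg: "emeasure ?M {..s} = 0" if "s \<le> 0" for s
    using emeasure_mono[of "{..s}" "{..0}" ?M] that by auto
  show ?thesis
  proof (rule measure_eqI_generator_eq[where E = "range atMost" and \<Omega> = UNIV and A = "\<lambda>i. {..real i}"])
    show "Int_stable (range (atMost :: real \<Rightarrow> real set))"
      by (auto simp: Int_stable_def)
    show "emeasure ?M X = emeasure (sq_dist (card A)) X" if "X \<in> range atMost" for X
    proof -
      from that obtain s where X: "X = {..s}" by (rule imageE)
      show ?thesis
      proof (cases "s > 0")
        case True
        then have "sqrt s ^ card A = max 0 s powr (card A / 2)"
          by (simp add: powr_half_sqrt[symmetric] powr_power)
        then show ?thesis unfolding X using pos[OF True] n by (simp add: emeasure_sq_dist_atMost)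
      next
        case False
        then show ?thesis unfolding X using neg[of s] n by (simp add: emeasure_sq_dist_atMost max_def)
      qed
    qed
    show "sets ?M = sigma_sets UNIV (range atMost)" "sets (sq_dist (card A)) = sigma_sets UNIV (range atMost)"
      by (simp_all add: sq_dist_def borel_eq_atMost)
    show "(\<Union>i. {..real i}) = UNIV"
      using real_arch_simple by blast
    show "emeasure ?M {..real i} \<noteq> \<infinity>" for i
      using pos[of "real i"] neg[of "real i"] by (cases "i = 0") auto
  qed auto
qed

lemma nn_integral_sq_dist:
  assumes n: "n > 0"
  shows "(\<integral>\<^sup>+s. ennreal ((1 - s) powr (- 1 / 2)) * indicator {..<1} s \<partial>sq_dist n) =
    ennreal (unit_ball_vol n * (n / 2) * Beta (n / 2) (1 / 2))"
proof -
  have "((\<lambda>t. t powr (n / 2 - 1) * (1 - t) powr (1 / 2 - 1)) has_integral Beta (n / 2) (1 / 2)) {0..1}"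
    using n by (intro has_integral_Beta_real) auto
  then have I: "((\<lambda>t. unit_ball_vol n * (n / 2) * (t powr (n / 2 - 1) * (1 - t) powr (1 / 2 - 1))) has_integral
      unit_ball_vol n * (n / 2) * Beta (n / 2) (1 / 2)) {0..1}"
    by (rule has_integral_mult_right)
  have "(\<integral>\<^sup>+s. ennreal ((1 - s) powr (- 1 / 2)) * indicator {..<1} s \<partial>sq_dist n) =
    (\<integral>\<^sup>+s. ennreal (unit_ball_vol n * (n / 2) * s powr (n / 2 - 1)) * indicator {0..} s *
      (ennreal ((1 - s) powr (- 1 / 2)) * indicator {..<1} s) \<partial>lborel)"
    unfolding sq_dist_def by (subst nn_integral_density) auto
  also have "\<dots> = (\<integral>\<^sup>+s. ennreal (indicator {0..1} s *\<^sub>R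
      (unit_ball_vol n * (n / 2) * (s powr (n / 2 - 1) * (1 - s) powr (1 / 2 - 1)))) \<partial>lborel)"
    using n by (intro nn_integral_cong)
      (auto simp: indicator_def ennreal_mult'[symmetric] mult_ac)
  also have "\<dots> = ennreal (unit_ball_vol n * (n / 2) * Beta (n / 2) (1 / 2))"
    using nn_integral_has_integral_lebesgue[OF _ I] n by (simp add: mult.commute)
  finally show ?thesis .
qed

lemma unit_ball_vol_Beta:
  assumes n: "n > 0"
  shows "2 * (unit_ball_vol n * (n / 2) * Beta (n / 2) (1 / 2)) = (n + 1) * unit_ball_vol (n + 1)"
proof -
  define A where "A = Gamma (n / 2)"
  define B where "B = Gamma ((n + 1) / 2)"
  have A: "A > 0" and B: "B > 0" using n by (auto simp: A_def B_def)
  have 1: "Gamma (n / 2 + 1) = n / 2 * A"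
    using n Gamma_plus1[of "n / 2"] nonpos_Ints_nonpos[of "n / 2"] by (auto simp: A_def)
  have 2: "Gamma ((n + 1) / 2 + 1) = (n + 1) / 2 * B"
    using n Gamma_plus1[of "(n + 1) / 2"] nonpos_Ints_nonpos[of "(n + 1) / 2"] by (auto simp: B_def)
  have 3: "Beta (n / 2) (1 / 2) = A * sqrt pi / B"
    by (simp add: Beta_def A_def B_def Gamma_one_half_real add_divide_distrib)
  have 4: "pi powr ((n + 1) / 2) = pi powr (n / 2) * sqrt pi"
    by (simp add: add_divide_distrib powr_add powr_half_sqrt)
  show ?thesis
    unfolding unit_ball_vol_def 1 2 3 4 using A B n by (simp add: divide_simps)
qed

text \<open>
  For the graph of $\pm\sqrt{1 - |y|^2}$ the area density $\sqrt{1 + |\nabla g|^2}$ is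
  $(1 - |y|^2)^{-1/2}$, a function of $|y|^2$ only. The factor \<open>s\<close> is the sign of the hemisphere.
\<close>

lemma hemisphere_area:
  fixes e :: "'a::euclidean_space" and s :: real
  assumes dim: "DIM('a) \<ge> 2" and e: "e \<in> Basis" and s: "s\<^sup>2 = 1"
  defines "n \<equiv> real DIM('a) - 1"
  shows "graph_area e {y. y \<bullet> e = 0 \<and> norm y < 1} (\<lambda>y. s * sqrt (1 - (norm y)\<^sup>2)) =
    ennreal (unit_ball_vol n * (n / 2) * Beta (n / 2) (1 / 2))"
proof -
  let ?D = "{y. y \<bullet> e = 0 \<and> norm y < 1}"
  let ?B = "Basis - {e}"
  let ?g = "\<lambda>y. s * sqrt (1 - (norm y)\<^sup>2)"
  let ?h = "\<lambda>s. ennreal ((1 - s) powr (- 1 / 2)) * indicator {..<1} s"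
  have card: "card ?B = DIM('a) - 1" using e by simp
  then have n: "real (card ?B) = n" using dim by (simp add: n_def of_nat_diff)
  have B: "finite ?B" "?B \<noteq> {}"
  proof -
    show "finite ?B" by simp
    show "?B \<noteq> {}"
    proof
      assume "?B = {}"
      then have "card ?B = 0" by (simp only: card.empty)
      with card dim show False by linarith
    qed
  qed
  have integrand: "ennreal (sqrt (1 + (\<Sum>b\<in>?B. (deriv (\<lambda>t. ?g (y + t *\<^sub>R b)) 0)\<^sup>2))) =
      ennreal ((1 - y \<bullet> y) powr (- 1 / 2))" if y: "y \<in> ?D" for y
  proof -
    have yy: "y \<bullet> y < 1" using y by (simp add: power2_norm_eq_inner[symmetric] power_less_one_iff)
    have d: "deriv (\<lambda>t. ?g (y + t *\<^sub>R b)) 0 = - s * (y \<bullet> b) / sqrt (1 - y \<bullet> y)" if b: "b \<in> ?B" for b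
    proof (rule DERIV_imp_deriv)
      let ?q = "\<lambda>t. 1 - (y \<bullet> y + 2 * t * (y \<bullet> b) + t\<^sup>2 * (b \<bullet> b))"
      have "((\<lambda>t. 1 - (A + 2 * t * B + t\<^sup>2 * C)) has_real_derivative - 2 * B) (at 0)" for A B C :: real
        by (auto intro!: derivative_eq_intros)
      then have "(?q has_real_derivative - 2 * (y \<bullet> b)) (at 0)" .
      moreover have "(sqrt has_real_derivative inverse (sqrt (1 - y \<bullet> y)) / 2) (at (?q 0))"
        using DERIV_real_sqrt[of "1 - y \<bullet> y"] yy by simp
      ultimately have *: "((\<lambda>t. s * sqrt (?q t)) has_real_derivative
          s * (inverse (sqrt (1 - y \<bullet> y)) / 2 * (- 2 * (y \<bullet> b)))) (at 0)"
        by (intro DERIV_cmult DERIV_chain2[where f = sqrt and g = ?q])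
      have val: "s * (inverse (sqrt (1 - y \<bullet> y)) / 2 * (- 2 * (y \<bullet> b))) =
          - s * (y \<bullet> b) / sqrt (1 - y \<bullet> y)"
        using yy by (simp add: field_simps)
      have "(y + t *\<^sub>R b) \<bullet> (y + t *\<^sub>R b) = y \<bullet> y + 2 * t * (y \<bullet> b) + t\<^sup>2 * (b \<bullet> b)" for t
        by (simp add: inner_add_left inner_add_right inner_commute[of b y] power2_eq_square distrib_left mult.assoc)
      then have fn: "(\<lambda>t. s * sqrt (?q t)) = (\<lambda>t. ?g (y + t *\<^sub>R b))"
        by (simp only: power2_norm_eq_inner)
      show "((\<lambda>t. ?g (y + t *\<^sub>R b)) has_real_derivative - s * (y \<bullet> b) / sqrt (1 - y \<bullet> y)) (at 0)"
        using * unfolding fn val .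
    qed
    have "(\<Sum>b\<in>?B. (y \<bullet> b)\<^sup>2) = (\<Sum>b\<in>Basis. (y \<bullet> b)\<^sup>2)"
      using y by (intro sum.mono_neutral_left) auto
    also have "\<dots> = y \<bullet> y" by (simp add: euclidean_inner[of y y] power2_eq_square)
    finally have "(\<Sum>b\<in>?B. (deriv (\<lambda>t. ?g (y + t *\<^sub>R b)) 0)\<^sup>2) = y \<bullet> y / (1 - y \<bullet> y)"
      using yy by (simp add: d power_divide power_mult_distrib s sum_divide_distrib[symmetric])
    then have "1 + (\<Sum>b\<in>?B. (deriv (\<lambda>t. ?g (y + t *\<^sub>R b)) 0)\<^sup>2) = 1 / (1 - y \<bullet> y)"
      using yy by (simp add: field_simps)
    then show ?thesis
      using yy by (simp add: powr_minus_divide powr_half_sqrt real_sqrt_divide)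
  qed
  have "graph_area e ?D ?g = (\<integral>\<^sup>+y. ennreal ((1 - y \<bullet> y) powr (- 1 / 2)) * indicator ?D y \<partial>hyperplane_lborel e)"
    unfolding graph_area_def
    by (intro nn_integral_cong) (auto simp: indicator_def integrand)
  also have "\<dots> = (\<integral>\<^sup>+f. ennreal ((1 - (\<Sum>b\<in>?B. f b *\<^sub>R b) \<bullet> (\<Sum>b\<in>?B. f b *\<^sub>R b)) powr (- 1 / 2)) *
      indicator ?D (\<Sum>b\<in>?B. f b *\<^sub>R b) \<partial>(\<Pi>\<^sub>M b\<in>?B. lborel))"
    unfolding hyperplane_lborel_def by (subst nn_integral_distr) measurable
  also have "\<dots> = (\<integral>\<^sup>+f. ?h (\<Sum>b\<in>?B. (f b)\<^sup>2) \<partial>(\<Pi>\<^sub>M b\<in>?B. lborel))"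
  proof (rule nn_integral_cong)
    fix f :: "'a \<Rightarrow> real"
    let ?y = "\<Sum>b\<in>?B. f b *\<^sub>R b"
    have inner: "?y \<bullet> i = (if i = e then 0 else f i)" if "i \<in> Basis" for i
    proof -
      have "?y \<bullet> i = (\<Sum>b\<in>?B. f b * (if b = i then 1 else 0))"
        unfolding inner_sum_left using that by (intro sum.cong) (auto simp: inner_Basis)
      also have "\<dots> = (if i = e then 0 else f i)"
        using that by (simp add: if_distrib sum.delta cong: if_cong)
      finally show ?thesis .
    qed
    have "?y \<bullet> ?y = (\<Sum>i\<in>Basis. (if i = e then 0 else f i)\<^sup>2)"
      by (subst euclidean_inner) (simp add: inner power2_eq_square cong: if_cong)
    also have "\<dots> = (\<Sum>b\<in>?B. (f b)\<^sup>2)"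
      by (rule sum.mono_neutral_cong_right) auto
    finally have yy: "?y \<bullet> ?y = (\<Sum>b\<in>?B. (f b)\<^sup>2)" .
    have "?y \<in> ?D \<longleftrightarrow> (\<Sum>b\<in>?B. (f b)\<^sup>2) < 1"
      using inner[OF e] by (simp add: yy[symmetric] norm_lt_square)
    then show "ennreal ((1 - ?y \<bullet> ?y) powr (- 1 / 2)) * indicator ?D ?y = ?h (\<Sum>b\<in>?B. (f b)\<^sup>2)"
      by (simp add: yy indicator_def)
  qed
  also have "\<dots> = (\<integral>\<^sup>+s. ?h s \<partial>distr (\<Pi>\<^sub>M b\<in>?B. lborel) borel (\<lambda>f. \<Sum>b\<in>?B. (f b)\<^sup>2))"
    by (subst nn_integral_distr) measurable
  also have "\<dots> = ennreal (unit_ball_vol n * (n / 2) * Beta (n / 2) (1 / 2))"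
    unfolding distr_sum_squares[OF B] n using dim by (intro nn_integral_sq_dist) (simp add: n_def)
  finally show ?thesis .
qed

theorem unit_sphere_area_eq:
  assumes dim: "DIM('a::euclidean_space) \<ge> 2"
  shows "unit_sphere_area TYPE('a) = real DIM('a) * measure lborel (ball (0 :: 'a) 1)"
proof -
  define e where "e = (SOME e :: 'a. e \<in> Basis)"
  have e: "e \<in> Basis" unfolding e_def using nonempty_Basis by (simp add: some_in_eq)
  define n where "n = real DIM('a) - 1"
  define I where "I = unit_ball_vol n * (n / 2) * Beta (n / 2) (1 / 2)"
  have n: "n > 0" using dim by (simp add: n_def)
  have I: "I \<ge> 0" using n by (simp add: I_def Beta_def)
  have "unit_sphere_area TYPE('a) = enn2real (ennreal I + ennreal I)"
    unfolding unit_sphere_area_def Let_def e_def[symmetric] I_def n_def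
    using hemisphere_area[OF dim e, of 1] hemisphere_area[OF dim e, of "- 1"] by simp
  also have "\<dots> = 2 * I" using I by (simp flip: ennreal_plus)
  also have "\<dots> = (n + 1) * unit_ball_vol (n + 1)" unfolding I_def using unit_ball_vol_Beta[OF n] .
  also have "\<dots> = real DIM('a) * measure lborel (ball (0 :: 'a) 1)"
    by (simp add: n_def content_ball)
  finally show ?thesis .
qed

section \<open>Dependence of the eigenvalue on the radius\<close>

theorem theorem5p1:
  fixes \<beta> c :: real and \<Sigma> \<sigma>\<^sub>1 :: "real \<Rightarrow> real"
  assumes dim: "DIM('a::euclidean_space) \<ge> 2"
    and beta: "\<beta> > 0"
  defines "\<Sigma> \<equiv> Sigma_fun TYPE('a) \<beta>"
    and "\<sigma>\<^sub>1 \<equiv> principal_eigenvalue TYPE('a) \<beta>"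
    and "c \<equiv> \<beta> * (unit_sphere_area TYPE('a) / measure lborel (ball (0::'a) 1))"
  shows "(\<forall>R>0. \<Sigma> R = R\<^sup>2 * \<sigma>\<^sub>1 R) \<and>
    real_analytic_on \<Sigma> UNIV \<and>
    (\<lambda>R. \<Sigma> R - c * R) \<in> O[at_right 0](\<lambda>R. R\<^sup>2) \<and>
    ((\<lambda>R. \<Sigma> R / R) \<longlongrightarrow> c) (at_right 0) \<and>
    (\<forall>R>0. \<sigma>\<^sub>1 R = \<Sigma> R / R\<^sup>2) \<and>
    (\<lambda>R. \<sigma>\<^sub>1 R - c * (1 / R)) \<in> O[at_right 0](\<lambda>R. 1)"
proof -
  define a where "a = real DIM('a) / 2"
  have a: "1 \<le> a" using dim by (simp add: a_def)
  have \<Sigma>: "\<Sigma> = (\<lambda>R. robin_inv a (\<beta> * R))"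
    using principal_eigenvalue_ball[OF dim, of 1]
    by (simp add: fun_eq_iff \<Sigma>_def Sigma_fun_def a_def)
  have \<sigma>: "\<sigma>\<^sub>1 R = \<Sigma> R / R\<^sup>2" if "R > 0" for R
    using principal_eigenvalue_ball[OF dim that] by (simp add: \<Sigma> \<sigma>\<^sub>1_def a_def)
  have c: "c = \<beta> * (2 * a)"
  proof -
    have "measure lborel (ball (0 :: 'a) 1) > 0" by simp
    then show ?thesis unfolding c_def unit_sphere_area_eq[OF dim] by (simp add: a_def)
  qed
  have analytic: "real_analytic_on \<Sigma> UNIV"
    unfolding \<Sigma> using beta by (intro real_analytic_on_scale robin_inv_analytic a) simp
  have \<Sigma>0: "\<Sigma> 0 = 0" using robin_inv_0[OF a] by (simp add: \<Sigma>)
  have deriv: "(\<Sigma> has_real_derivative c) (at 0)"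
  proof -
    have "(robin_inv a has_real_derivative 2 * a) (at (\<beta> * 0))"
      using DERIV_robin_inv_0[OF a] by simp
    moreover have "((\<lambda>R. \<beta> * R) has_real_derivative \<beta>) (at 0)"
      by (auto intro!: derivative_eq_intros)
    ultimately have "((\<lambda>R. robin_inv a (\<beta> * R)) has_real_derivative 2 * a * \<beta>) (at 0)"
      by (rule DERIV_chain2)
    then show ?thesis by (simp only: \<Sigma> c mult.commute)
  qed
  have right: "at_right 0 \<le> at (0 :: real)" by (rule at_le) simp
  have pos: "eventually (\<lambda>R :: real. R > 0) (at_right 0)"
    by (simp add: eventually_at_right_less)
  obtain L where "((\<lambda>R. (\<Sigma> R - c * R) / R\<^sup>2) \<longlongrightarrow> L) (at 0)"
    using real_analytic_at_0_quadratic_remainder[OF analytic \<Sigma>0 deriv] by blast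
  then have L: "((\<lambda>R. (\<Sigma> R - c * R) / R\<^sup>2) \<longlongrightarrow> L) (at_right 0)"
    by (rule tendsto_mono[OF right])
  have O2: "(\<lambda>R. \<Sigma> R - c * R) \<in> O[at_right 0](\<lambda>R. R\<^sup>2)"
    using pos by (intro bigoI_tendsto[OF L]) (auto elim: eventually_mono)
  have lim: "((\<lambda>R. \<Sigma> R / R) \<longlongrightarrow> c) (at_right 0)"
  proof (rule tendsto_mono[OF right])
    show "((\<lambda>R. \<Sigma> R / R) \<longlongrightarrow> c) (at 0)"
      using deriv \<Sigma>0 by (simp add: has_field_derivative_iff)
  qed
  have "((\<lambda>R. (\<sigma>\<^sub>1 R - c * (1 / R)) / 1) \<longlongrightarrow> L) (at_right 0)"
  proof (rule Lim_transform_eventually[OF L])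
    show "eventually (\<lambda>R. (\<Sigma> R - c * R) / R\<^sup>2 = (\<sigma>\<^sub>1 R - c * (1 / R)) / 1) (at_right 0)"
      using pos by eventually_elim (simp add: \<sigma> diff_divide_distrib power2_eq_square)
  qed
  then have O1: "(\<lambda>R. \<sigma>\<^sub>1 R - c * (1 / R)) \<in> O[at_right 0](\<lambda>R. 1)"
    by (rule bigoI_tendsto) simp
  show ?thesis
    using \<sigma> analytic O2 lim O1 by simp
qed

end
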